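(* Consider the East model on $\mathbb{Z}$ with parameter $p\in[0,1)$ and reversible Bernoulli($p$) product measure $\mu$. Let $\eta\in\{0,1\}^{\mathbb{Z}}$ be any configuration such that there is an infinite number of $0$'s to the right of the origin. Then there exists $m>0$ and, for any local function $f$, there exist $C_f<\infty$ and $t_0(\eta,f)$ such that for any $t>t_0(\eta,f)$ $$\bigl|\mathbb{E}\bigl(f(\eta_t)\bigr)-\mu(f)\bigr|\le C_f\,e^{-mt}.$$
   Context: Let $\Omega=\{0,1\}^{\mathbb{Z}}$ and let $\mu=\bigotimes_{x\in\mathbb{Z}}\mu_x$ be the product measure with each $\mu_x$ Bernoulli($p$) on $\{0,1\}$ (value $1$ with probability $p$). A function $f:\Omega\to\mathbb{R}$ is local if it depends on finitely many variables. The East model is the Markov process on $\Omega$ whose generator acts on local functions by $$\mathcal{L}f(\omega)=\sum_{x\in\mathbb{Z}}(1-\omega_{x+1})\,[\mu_x(f)-f(\omega)],$$ where $\mu_x(f)=\int d\mu_x(\omega_x)f(\omega)$ averages over $\omega_x$ only, all other variables being held fixed. That is, each site $x$ has an independent rate-one Poisson clock; when it rings, if the spin at $x+1$ is $0$ the spin at $x$ is replaced by an independent Bernoulli($p$) variable, and otherwise nothing happens. $\mathbb{E}(f(\eta_t))$ denotes the expectation of $f$ at time $t$ over the process started from the configuration $\eta$. *)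

theory Defs
  imports "HOL-Probability.Probability"
begin

section \<open>Feller semigroups, their generators, and Markov processes\<close>

text \<open>A Feller semigroup on a compact state space, given by its transition kernels: \<open>P t x\<close> is
  the law at time \<open>t\<close> of the process started from \<open>x\<close>.  Nothing is required at negative times.\<close>

definition feller_semigroup :: "(real \<Rightarrow> 'a::topological_space \<Rightarrow> 'a measure) \<Rightarrow> bool" where
  "feller_semigroup P \<longleftrightarrow>
     (\<forall>t\<ge>0. P t \<in> borel \<rightarrow>\<^sub>M prob_algebra borel) \<and>
     (\<forall>x. P 0 x = return borel x) \<and>
     (\<forall>s\<ge>0. \<forall>t\<ge>0. \<forall>x. P (s + t) x = bind (P s x) (P t)) \<and>
     (\<forall>f::'a \<Rightarrow> real. continuous_on UNIV f \<longrightarrow>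
        (\<forall>t\<ge>0. continuous_on UNIV (\<lambda>x. \<integral>y. f y \<partial>P t x)) \<and>
        uniform_limit UNIV (\<lambda>t x. \<integral>y. f y \<partial>P t x) f (at_right 0))"

text \<open>The graph of the infinitesimal generator, as an operator on continuous functions with the
  supremum norm.\<close>

definition generator ::
    "(real \<Rightarrow> 'a::topological_space \<Rightarrow> 'a measure) \<Rightarrow> (('a \<Rightarrow> real) \<times> ('a \<Rightarrow> real)) set" where
  "generator P = {(f, g). continuous_on UNIV f \<and> continuous_on UNIV g \<and>
     uniform_limit UNIV (\<lambda>t x. ((\<integral>y. f y \<partial>P t x) - f x) / t) g (at_right 0)}"

definition past :: "'w measure \<Rightarrow> (real \<Rightarrow> 'w \<Rightarrow> 'a::topological_space) \<Rightarrow> real \<Rightarrow> 'w measure" where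
  "past M X s = sigma (space M)
     {X u -` B \<inter> space M | u B. 0 \<le> u \<and> u \<le> s \<and> B \<in> sets borel}"

text \<open>\<open>X\<close>, on the probability space \<open>M\<close>, is a Markov process with transition kernels \<open>P\<close> started
  from \<open>x\<close>.\<close>

definition markov_process ::
    "(real \<Rightarrow> 'a::topological_space \<Rightarrow> 'a measure) \<Rightarrow> 'a \<Rightarrow> 'w measure \<Rightarrow> (real \<Rightarrow> 'w \<Rightarrow> 'a) \<Rightarrow> bool"
  where
  "markov_process P x M X \<longleftrightarrow>
     prob_space M \<and>
     (\<forall>t\<ge>0. X t \<in> M \<rightarrow>\<^sub>M borel) \<and>
     (AE w in M. X 0 w = x) \<and>
     (\<forall>s\<ge>0. \<forall>t\<ge>0. \<forall>B\<in>sets borel. AE w in M.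
        real_cond_exp M (past M X s) (\<lambda>v. indicator B (X (s + t) v)) w
          = measure (P t (X s w)) B)"

section \<open>The East model\<close>

text \<open>Spins are Booleans, \<open>True\<close> standing for the value 1 and \<open>False\<close> for 0.  The type
  \<open>int \<Rightarrow> bool\<close> carries the product of the discrete topologies, hence is compact, and its Borel
  sets are those of the product \<open>\<sigma>\<close>-algebra.\<close>

type_synonym config = "int \<Rightarrow> bool"

definition bernoulli_product :: "real \<Rightarrow> config measure" where
  "bernoulli_product p = PiM UNIV (\<lambda>_. measure_pmf (bernoulli_pmf p))"

definition depends_only_on :: "(config \<Rightarrow> real) \<Rightarrow> int set \<Rightarrow> bool" where
  "depends_only_on f A \<longleftrightarrow> (\<forall>\<xi> \<xi>'. (\<forall>x\<in>A. \<xi> x = \<xi>' x) \<longrightarrow> f \<xi> = f \<xi>')"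

definition local_fun :: "(config \<Rightarrow> real) \<Rightarrow> bool" where
  "local_fun f \<longleftrightarrow> (\<exists>A. finite A \<and> depends_only_on f A)"

definition site_average :: "real \<Rightarrow> int \<Rightarrow> (config \<Rightarrow> real) \<Rightarrow> config \<Rightarrow> real" where
  "site_average p x f \<xi> = (\<integral>b. (f (\<xi>(x := b))) \<partial>measure_pmf (bernoulli_pmf p))"

text \<open>For a local function only finitely many terms of the sum over all sites are nonzero, see
  \<open>east_generator_eq_sum\<close> below.\<close>

definition east_generator :: "real \<Rightarrow> (config \<Rightarrow> real) \<Rightarrow> config \<Rightarrow> real" where
  "east_generator p f \<xi> =
     (\<Sum>\<^sub>\<infinity>x. (1 - of_bool (\<xi> (x + 1))) * (site_average p x f \<xi> - f \<xi>))"

lemma east_generator_eq_sum: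
  assumes "finite A" "depends_only_on f A"
  shows "east_generator p f \<xi> =
    (\<Sum>x\<in>A. (1 - of_bool (\<xi> (x + 1))) * (site_average p x f \<xi> - f \<xi>))"
proof -
  have "site_average p x f \<xi> = f \<xi>" if "x \<notin> A" for x
  proof -
    have "f (\<xi>(x := b)) = f \<xi>" for b
      using assms(2) that unfolding depends_only_on_def by (metis fun_upd_apply)
    then show ?thesis by (simp add: site_average_def)
  qed
  then have "east_generator p f \<xi> =
      infsum (\<lambda>x. (1 - of_bool (\<xi> (x + 1))) * (site_average p x f \<xi> - f \<xi>)) A"
    unfolding east_generator_def by (intro infsum_cong_neutral) auto
  with assms(1) show ?thesis by simp
qed

text \<open>The local functions form a core of the closure of \<open>east_generator p\<close>, so at most one Feller
  semigroup satisfies the following; that closure generates it.\<close>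

definition east_semigroup :: "real \<Rightarrow> (real \<Rightarrow> config \<Rightarrow> config measure) \<Rightarrow> bool" where
  "east_semigroup p P \<longleftrightarrow>
     feller_semigroup P \<and> (\<forall>f. local_fun f \<longrightarrow> (f, east_generator p f) \<in> generator P)"

definition east_process ::
    "real \<Rightarrow> config \<Rightarrow> 'w measure \<Rightarrow> (real \<Rightarrow> 'w \<Rightarrow> config) \<Rightarrow> bool" where
  "east_process p \<eta> M X \<longleftrightarrow> (\<exists>P. east_semigroup p P \<and> markov_process P \<eta> M X)"

end

theory Submission
  imports Defs
begin

text \<open>Influence in the East model travels from right to left only, so one may follow a
  distinguished zero: it starts at an empty site \<open>z\<close> to the right of the support of \<open>f\<close> and jumps to
  \<open>x + 1\<close> whenever there is a legal ring at its position \<open>x\<close>.  Averaged over the spins to the left of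
  the distinguished zero, \<open>f - \<mu>(f)\<close> keeps mean zero for all times, and its square mean decays
  exponentially, because to the left of an empty site the Dirichlet form satisfies a Poincare
  inequality whose constant does not depend on the length of the interval.  A single configuration
  left of \<open>z\<close> has positive mass if \<open>p > 0\<close>, which turns the square mean bound into a pointwise one.
  All this is carried out for the Euler scheme of the dynamics frozen at and beyond a far site \<open>R\<close>,
  which involves only finite sums.  The semigroup is recovered as the mesh tends to 0 and then
  \<open>R\<close> to infinity, by finite speed of propagation.\<close>

section \<open>Elementary inequalities\<close>

text \<open>The process is given only through its kernels and their generator on local functions, so
  the distinguished zero is not followed as a random path. What is propagated is a property of
  functions: for every \<open>x\<close> right of the support and every configuration with
  \<open>x\<close> empty, the average over \<open>{a..<x}\<close> vanishes and the average of the
  square is at most \<open>N\<close>. An Euler step preserves the first and improves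
  \<open>N\<close>, since a legal ring at \<open>x\<close> merely replaces \<open>x\<close> by
  \<open>x + 1\<close>. As the zero drifts right without control, the interval left of it grows;
  this is why the Poincare constant \<gamma> must not depend on the length. For \<open>p > 0\<close>
  the final rate is \<gamma> / 2, half of it lost in the square root. It depends on \<open>p\<close>
  only, whereas the prefactor carries the mass of a configuration on \<open>{a..<z}\<close> and so
  the position of \<open>z\<close>. Freezing answers another obstacle: the generator of a function
  of the spins up to \<open>R\<close> reads the spin at \<open>R + 1\<close>, so unfrozen iterates
  would leave every finite window, while the generator is controlled uniformly on a fixed
  window.\<close>

lemma depends_only_on_comp:
  "depends_only_on f A \<Longrightarrow> depends_only_on (\<lambda>\<xi>. h (f \<xi>)) A"
  unfolding depends_only_on_def by metis

lemma sum_telescope_int: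
  fixes \<phi> :: "int \<Rightarrow> real"
  shows "a \<le> v \<Longrightarrow> (\<Sum>y\<in>{a..<v}. \<phi> (y + 1) - \<phi> y) = \<phi> v - \<phi> a"
proof (induction v rule: int_ge_induct)
  case (step v)
  then have "{a..<v + 1} = insert v {a..<v}" by auto
  with step show ?case by simp
qed simp

text \<open>Double counting: a site \<open>w\<close> lies in the windows of at most
  \<open>l + 1\<close> sites \<open>y\<close>.\<close>

lemma window_sum_le:
  fixes T :: "int \<Rightarrow> real"
  assumes "finite S" "\<And>w. 0 \<le> T w"
  shows "(\<Sum>y\<in>S. \<Sum>w\<in>{w \<in> S. y \<le> w \<and> w \<le> y + int l}. T w) \<le> (real l + 1) * (\<Sum>w\<in>S. T w)"
proof -
  have "(\<Sum>y\<in>S. \<Sum>w\<in>{w \<in> S. y \<le> w \<and> w \<le> y + int l}. T w)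
      = (\<Sum>w\<in>S. \<Sum>y\<in>{y \<in> S. y \<le> w \<and> w \<le> y + int l}. T w)"
    using assms(1) by (intro sum.swap_restrict)
  also have "\<dots> \<le> (\<Sum>w\<in>S. (real l + 1) * T w)"
  proof (rule sum_mono)
    fix w
    have "card {y \<in> S. y \<le> w \<and> w \<le> y + int l} \<le> card {w - int l..w}"
      by (intro card_mono) auto
    then have "real (card {y \<in> S. y \<le> w \<and> w \<le> y + int l}) \<le> real l + 1" by simp
    then show "(\<Sum>y\<in>{y \<in> S. y \<le> w \<and> w \<le> y + int l}. T w) \<le> (real l + 1) * T w"
      using assms(2)[of w] by (simp add: mult_right_mono)
  qed
  finally show ?thesis by (simp add: sum_distrib_left)
qed

text \<open>The weighted variance about the mean \<open>m\<close> is nonnegative. The value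
  \<open>u\<close> is singled out because an Euler step will be read as a mixture of one inner step,
  of weight \<alpha>, and averages at sites further right.\<close>

lemma jensen_square:
  fixes u :: real
  assumes "finite I" "0 \<le> \<alpha>" "\<And>i. i \<in> I \<Longrightarrow> 0 \<le> w i" "\<alpha> + (\<Sum>i\<in>I. w i) = 1"
  shows "(\<alpha> * u + (\<Sum>i\<in>I. w i * v i))\<^sup>2 \<le> \<alpha> * u\<^sup>2 + (\<Sum>i\<in>I. w i * (v i)\<^sup>2)"
proof -
  define m where "m = \<alpha> * u + (\<Sum>i\<in>I. w i * v i)"
  have "0 \<le> \<alpha> * (u - m)\<^sup>2 + (\<Sum>i\<in>I. w i * (v i - m)\<^sup>2)"
    using assms by (intro add_nonneg_nonneg sum_nonneg mult_nonneg_nonneg) auto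
  also have "(\<Sum>i\<in>I. w i * (v i - m)\<^sup>2)
      = (\<Sum>i\<in>I. w i * (v i)\<^sup>2) - 2 * m * (\<Sum>i\<in>I. w i * v i) + m\<^sup>2 * (\<Sum>i\<in>I. w i)"
    by (simp add: sum_distrib_left sum_subtractf[symmetric] sum.distrib[symmetric]
        power2_eq_square algebra_simps)
  also have "(\<Sum>i\<in>I. w i * v i) = m - \<alpha> * u" by (simp add: m_def)
  also have "(\<Sum>i\<in>I. w i) = 1 - \<alpha>" using assms(4) by simp
  finally have "m\<^sup>2 \<le> \<alpha> * u\<^sup>2 + (\<Sum>i\<in>I. w i * (v i)\<^sup>2)"
    by (simp add: power2_eq_square algebra_simps)
  then show ?thesis by (simp only: m_def)
qed

lemma one_minus_power_le_exp:
  fixes x :: real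
  assumes "0 \<le> x" "x \<le> 1"
  shows "(1 - x) ^ n \<le> exp (- (x * real n))"
proof -
  have "(1 - x) ^ n \<le> exp (- x) ^ n"
    using assms exp_ge_add_one_self[of "- x"] by (intro power_mono) auto
  then show ?thesis by (simp add: exp_of_nat_mult[symmetric] mult.commute)
qed

section \<open>Averages over finitely many spins\<close>

locale east =
  fixes p :: real
  assumes p_nonneg: "0 \<le> p" and p_less_1: "p < 1"
begin

definition avg :: "int \<Rightarrow> (config \<Rightarrow> real) \<Rightarrow> config \<Rightarrow> real" where
  "avg x g \<zeta> = p * g (\<zeta>(x := True)) + (1 - p) * g (\<zeta>(x := False))"

lemma avg_commute: "avg x (avg y g) = avg y (avg x g)"
  by (cases "x = y") (auto simp: avg_def fun_upd_twist algebra_simps)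

lemma avg_idem: "avg x (avg x g) = avg x g"
  by (auto simp: avg_def algebra_simps)

text \<open>Idempotence, and not only commutation, lets \<open>mean_union\<close> hold for
  overlapping sets: averaging a site twice is harmless.\<close>

sublocale comp_fun_idem avg
  by unfold_locales (auto simp: fun_eq_iff avg_commute avg_idem)

text \<open>The conditional expectation given the spins outside \<open>S\<close>. It remains a
  function because the boundary condition, in particular an empty site to the right, enters all
  later estimates.\<close>

definition mean :: "int set \<Rightarrow> (config \<Rightarrow> real) \<Rightarrow> config \<Rightarrow> real" where
  "mean S g = Finite_Set.fold avg g S"

lemma mean_empty [simp]: "mean {} g = g"
  by (simp add: mean_def)

lemma mean_insert: "finite S \<Longrightarrow> mean (insert x S) g = avg x (mean S g)"
  by (simp add: mean_def)

lemma mean_union: "finite S \<Longrightarrow> finite T \<Longrightarrow> mean (S \<union> T) g = mean S (mean T g)"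
  by (induction S rule: finite_induct) (auto simp: mean_insert)

lemma mean_avg: "finite S \<Longrightarrow> mean S (avg x g) = mean (insert x S) g"
  using mean_union[of S "{x}" g] mean_insert[of "{}" x g] by simp

text \<open>The comparison is required only at configurations that agree with \<zeta> off
  \<open>S\<close>; this makes an empty boundary site available inside the average.\<close>

lemma mean_mono:
  assumes "finite S" "\<And>\<xi>. (\<And>y. y \<notin> S \<Longrightarrow> \<xi> y = \<zeta> y) \<Longrightarrow> f \<xi> \<le> g \<xi>"
  shows "mean S f \<zeta> \<le> mean S g \<zeta>"
  using assms
proof (induction S arbitrary: \<zeta> rule: finite_induct)
  case (insert x S)
  have "mean S f (\<zeta>(x := b)) \<le> mean S g (\<zeta>(x := b))" for b
    using insert.hyps by (intro insert.IH insert.prems) auto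
  then show ?case
    using p_nonneg p_less_1 insert.hyps(1)
    by (auto simp: mean_insert avg_def intro!: add_mono mult_left_mono)
qed auto

lemma mean_cong:
  assumes "finite S" "\<And>\<xi>. (\<And>y. y \<notin> S \<Longrightarrow> \<xi> y = \<zeta> y) \<Longrightarrow> f \<xi> = g \<xi>"
  shows "mean S f \<zeta> = mean S g \<zeta>"
  using assms by (intro antisym mean_mono) auto

lemma mean_const [simp]: "finite S \<Longrightarrow> mean S (\<lambda>_. c) = (\<lambda>_. c)"
  by (induction S rule: finite_induct) (auto simp: mean_insert avg_def algebra_simps)

lemma mean_add: "finite S \<Longrightarrow> mean S (\<lambda>\<xi>. f \<xi> + g \<xi>) = (\<lambda>\<zeta>. mean S f \<zeta> + mean S g \<zeta>)"
  by (induction S rule: finite_induct) (auto simp: mean_insert avg_def algebra_simps)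

lemma mean_diff: "finite S \<Longrightarrow> mean S (\<lambda>\<xi>. f \<xi> - g \<xi>) = (\<lambda>\<zeta>. mean S f \<zeta> - mean S g \<zeta>)"
  by (induction S rule: finite_induct) (auto simp: mean_insert avg_def algebra_simps)

lemma mean_sum:
  "finite S \<Longrightarrow> mean S (\<lambda>\<xi>. \<Sum>i\<in>I. f i \<xi>) = (\<lambda>\<zeta>. \<Sum>i\<in>I. mean S (f i) \<zeta>)"
  by (induction S rule: finite_induct)
     (auto simp: mean_insert avg_def sum_distrib_left sum.distrib)

lemma mean_nonneg: "finite S \<Longrightarrow> (\<And>\<xi>. 0 \<le> g \<xi>) \<Longrightarrow> 0 \<le> mean S g \<zeta>"
  using mean_mono[of S \<zeta> "\<lambda>_. 0" g] by simp

lemma mean_factor: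
  assumes "finite S" "depends_only_on k (- S)"
  shows "mean S (\<lambda>\<xi>. k \<xi> * g \<xi>) \<zeta> = k \<zeta> * mean S g \<zeta>"
proof -
  have cmult: "mean S (\<lambda>\<xi>. c * g \<xi>) = (\<lambda>\<zeta>. c * mean S g \<zeta>)" for c
    using assms(1) by (induction S rule: finite_induct) (auto simp: mean_insert avg_def algebra_simps)
  have "mean S (\<lambda>\<xi>. k \<xi> * g \<xi>) \<zeta> = mean S (\<lambda>\<xi>. k \<zeta> * g \<xi>) \<zeta>"
  proof (rule mean_cong[OF assms(1)])
    fix \<xi> assume "\<And>y. y \<notin> S \<Longrightarrow> \<xi> y = \<zeta> y"
    then have "k \<xi> = k \<zeta>"
      using assms(2) by (simp add: depends_only_on_def)
    then show "k \<xi> * g \<xi> = k \<zeta> * g \<xi>" by simp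
  qed
  then show ?thesis by (simp add: cmult)
qed

lemma mean_cmult: "finite S \<Longrightarrow> mean S (\<lambda>\<xi>. c * g \<xi>) = (\<lambda>\<zeta>. c * mean S g \<zeta>)"
  by (auto intro!: mean_factor simp: depends_only_on_def)

lemma mean_indep: "finite S \<Longrightarrow> depends_only_on k (- S) \<Longrightarrow> mean S k = k"
  using mean_factor[of S k "\<lambda>_. 1"] by auto

lemma depends_mean: "finite S \<Longrightarrow> depends_only_on (mean S g) (- S)"
proof (induction S rule: finite_induct)
  case (insert x S)
  have "avg x (mean S g) \<xi> = avg x (mean S g) \<xi>'"
    if "\<forall>y\<in>- insert x S. \<xi> y = \<xi>' y" for \<xi> \<xi>'
  proof -
    have "mean S g (\<xi>(x := b)) = mean S g (\<xi>'(x := b))" for b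
      by (rule insert.IH[unfolded depends_only_on_def, rule_format]) (use that in auto)
    then show ?thesis by (simp add: avg_def)
  qed
  with insert.hyps show ?case by (simp add: mean_insert depends_only_on_def)
qed (auto simp: depends_only_on_def fun_eq_iff[symmetric])

lemma mean_square_le: "finite S \<Longrightarrow> (mean S g \<zeta>)\<^sup>2 \<le> mean S (\<lambda>\<xi>. (g \<xi>)\<^sup>2) \<zeta>"
proof -
  assume S: "finite S"
  define c where "c = mean S g \<zeta>"
  have "0 \<le> mean S (\<lambda>\<xi>. (g \<xi> - c)\<^sup>2) \<zeta>"
    using S by (intro mean_nonneg) auto
  also have "(\<lambda>\<xi>. (g \<xi> - c)\<^sup>2) = (\<lambda>\<xi>. ((g \<xi>)\<^sup>2 - (2 * c) * g \<xi>) + c\<^sup>2)"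
    by (auto simp: power2_eq_square algebra_simps)
  also have "mean S \<dots> \<zeta> = mean S (\<lambda>\<xi>. (g \<xi>)\<^sup>2) \<zeta> - c\<^sup>2"
    using S by (simp add: mean_add mean_diff mean_cmult c_def power2_eq_square)
  finally show ?thesis by (simp add: c_def)
qed

text \<open>Only one configuration of the spins in \<open>S\<close> survives the indicator, and it
  has mass \<open>p ^ card S\<close>.\<close>

lemma mean_all_True:
  "finite S \<Longrightarrow> mean S (\<lambda>\<xi>. of_bool (\<forall>y\<in>S. \<xi> y) * g \<xi>) \<zeta> = p ^ card S * g (\<lambda>y. y \<in> S \<or> \<zeta> y)"
proof (induction S arbitrary: \<zeta> g rule: finite_induct)
  case (insert x S)
  have "mean S (\<lambda>\<xi>. of_bool (\<forall>y\<in>insert x S. \<xi> y) * g \<xi>) \<zeta>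
      = of_bool (\<zeta> x) * (p ^ card S * g (\<lambda>y. y \<in> S \<or> \<zeta> y))" for \<zeta>
  proof -
    have "mean S (\<lambda>\<xi>. of_bool (\<xi> x) * (of_bool (\<forall>y\<in>S. \<xi> y) * g \<xi>)) \<zeta>
      = of_bool (\<zeta> x) * mean S (\<lambda>\<xi>. of_bool (\<forall>y\<in>S. \<xi> y) * g \<xi>) \<zeta>"
      using insert.hyps by (intro mean_factor) (auto simp: depends_only_on_def)
    moreover have "(\<lambda>\<xi>. of_bool (\<forall>y\<in>insert x S. \<xi> y) * g \<xi>)
      = (\<lambda>\<xi>. of_bool (\<xi> x) * (of_bool (\<forall>y\<in>S. \<xi> y) * g \<xi>))"
      by auto
    ultimately show ?thesis by (simp add: insert.IH)
  qed
  moreover have "(\<lambda>y. y \<in> S \<or> (\<zeta>(x := True)) y) = (\<lambda>y. y \<in> insert x S \<or> \<zeta> y)"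
    by auto
  ultimately show ?case using insert.hyps by (simp add: mean_insert avg_def)
qed auto

text \<open>The variance of \<open>g\<close> under resampling \<open>x\<close>, as the Bernoulli
  variance times a squared discrete derivative; \<open>vari_eq\<close> gives the usual form. The
  derivative form lets averages over other sites pass through.\<close>

definition vari :: "int \<Rightarrow> (config \<Rightarrow> real) \<Rightarrow> config \<Rightarrow> real" where
  "vari x g \<zeta> = p * (1 - p) * (g (\<zeta>(x := True)) - g (\<zeta>(x := False)))\<^sup>2"

lemma vari_eq: "vari x g \<zeta> = avg x (\<lambda>\<xi>. (g \<xi>)\<^sup>2) \<zeta> - (avg x g \<zeta>)\<^sup>2"
  by (simp add: vari_def avg_def power2_eq_square algebra_simps)

lemma vari_nonneg: "0 \<le> vari x g \<zeta>"
  using p_nonneg p_less_1 by (simp add: vari_def)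

lemma vari_add_le: "vari x (\<lambda>\<xi>. f \<xi> + g \<xi>) \<zeta> \<le> 2 * vari x f \<zeta> + 2 * vari x g \<zeta>"
proof -
  define u v where "u = f (\<zeta>(x := True)) - f (\<zeta>(x := False))"
    and "v = g (\<zeta>(x := True)) - g (\<zeta>(x := False))"
  have "(u + v)\<^sup>2 \<le> 2 * u\<^sup>2 + 2 * v\<^sup>2"
    using zero_le_power2[of "u - v"] by (simp add: power2_eq_square algebra_simps)
  then have "p * (1 - p) * (u + v)\<^sup>2 \<le> p * (1 - p) * (2 * u\<^sup>2 + 2 * v\<^sup>2)"
    using p_nonneg p_less_1 by (intro mult_left_mono) auto
  then show ?thesis by (simp add: vari_def u_def v_def algebra_simps)
qed

lemma vari_le_avg: "vari x g \<zeta> \<le> avg x (\<lambda>\<xi>. (g \<xi>)\<^sup>2) \<zeta>"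
  by (simp add: vari_eq)

lemma mean_upd: "finite S \<Longrightarrow> x \<notin> S \<Longrightarrow> mean S g (\<zeta>(x := b)) = mean S (\<lambda>\<xi>. g (\<xi>(x := b))) \<zeta>"
proof (induction S arbitrary: \<zeta> rule: finite_induct)
  case (insert y S)
  then have "x \<noteq> y" "x \<notin> S" by auto
  then have "mean S g (\<zeta>(x := b, y := c)) = mean S (\<lambda>\<xi>. g (\<xi>(x := b))) (\<zeta>(y := c))" for c
    unfolding fun_upd_twist[OF \<open>x \<noteq> y\<close>] by (intro insert.IH)
  then show ?case using insert.hyps(1) by (simp only: mean_insert avg_def)
qed simp

text \<open>The discrete derivative at \<open>x\<close> commutes with averages over other sites, and
  squaring is convex.\<close>

lemma vari_mean_le:
  assumes "finite S" "x \<notin> S"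
  shows "vari x (mean S g) \<zeta> \<le> mean S (vari x g) \<zeta>"
proof -
  have "vari x (mean S g) \<zeta>
      = p * (1 - p) * (mean S (\<lambda>\<xi>. g (\<xi>(x := True)) - g (\<xi>(x := False))) \<zeta>)\<^sup>2"
    using assms by (simp add: vari_def mean_upd mean_diff)
  also have "\<dots> \<le> p * (1 - p) * mean S (\<lambda>\<xi>. (g (\<xi>(x := True)) - g (\<xi>(x := False)))\<^sup>2) \<zeta>"
    using assms p_nonneg p_less_1 by (intro mult_left_mono mean_square_le) auto
  also have "\<dots> = mean S (vari x g) \<zeta>"
    using assms unfolding vari_def by (simp add: mean_cmult)
  finally show ?thesis .
qed

lemma vari_factor:
  "depends_only_on k (- {x}) \<Longrightarrow> vari x (\<lambda>\<xi>. k \<xi> * g \<xi>) \<zeta> = (k \<zeta>)\<^sup>2 * vari x g \<zeta>"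
proof -
  assume "depends_only_on k (- {x})"
  then have "k (\<zeta>(x := b)) = k \<zeta>" for b
    by (auto simp: depends_only_on_def)
  then show ?thesis by (simp add: vari_def power2_eq_square algebra_simps)
qed

text \<open>Martingale decomposition: \<open>mean {y..<v} g\<close> is the conditional expectation
  given the spins outside \<open>{y..<v}\<close>, and the increments from revealing one more site
  are orthogonal. In the proof \<phi> records the mean squares along this martingale.\<close>

lemma variance_telescope:
  assumes "a \<le> v"
  shows "mean {a..<v} (\<lambda>\<xi>. (g \<xi>)\<^sup>2) \<zeta> - (mean {a..<v} g \<zeta>)\<^sup>2
    = (\<Sum>y\<in>{a..<v}. mean {a..<v} (vari y (mean {y+1..<v} g)) \<zeta>)"
proof -
  define \<phi> where "\<phi> y = mean {a..<v} (\<lambda>\<xi>. (mean {y..<v} g \<xi>)\<^sup>2) \<zeta>" for y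
  have "mean {a..<v} (vari y (mean {y+1..<v} g)) \<zeta> = \<phi> (y + 1) - \<phi> y" if "y \<in> {a..<v}" for y
  proof -
    have "insert y {y+1..<v} = {y..<v}" "insert y {a..<v} = {a..<v}" using that by auto
    then have "avg y (mean {y+1..<v} g) = mean {y..<v} g"
      "mean {a..<v} (avg y h) = mean {a..<v} h" for h
      by (metis mean_insert finite_atLeastLessThan_int, metis mean_avg finite_atLeastLessThan_int)
    then show ?thesis
      by (simp add: vari_eq[abs_def] mean_diff \<phi>_def)
  qed
  then have "(\<Sum>y\<in>{a..<v}. mean {a..<v} (vari y (mean {y+1..<v} g)) \<zeta>) = \<phi> v - \<phi> a"
    using sum_telescope_int[OF assms, of \<phi>] by simp
  moreover have "\<phi> a = (mean {a..<v} g \<zeta>)\<^sup>2"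
  proof -
    have "depends_only_on (\<lambda>\<xi>. (mean {a..<v} g \<xi>)\<^sup>2) (- {a..<v})"
      by (rule depends_only_on_comp[where h = "\<lambda>x. x\<^sup>2", OF depends_mean]) simp
    then have "mean {a..<v} (\<lambda>\<xi>. (mean {a..<v} g \<xi>)\<^sup>2) = (\<lambda>\<xi>. (mean {a..<v} g \<xi>)\<^sup>2)"
      by (rule mean_indep[rotated]) simp
    then show ?thesis by (simp only: \<phi>_def)
  qed
  ultimately show ?thesis by (simp add: \<phi>_def)
qed

lemma mean_singleton: "mean {x} g = avg x g"
  by (simp add: mean_insert)

lemma mean_subset: "finite S \<Longrightarrow> T \<subseteq> S \<Longrightarrow> mean S (mean T g) = mean S g"
  by (metis mean_union finite_subset sup.absorb1)

text \<open>Under the average over \<open>S\<close> a resampling of \<open>w\<close> is invisible,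
  and it passes through a factor blind to \<open>w\<close>. The constraint of a ring at
  \<open>w\<close> is such a factor, as it looks only at \<open>w + 1\<close>.\<close>

lemma mean_factor_avg:
  assumes "finite S" "w \<in> S" "depends_only_on e (- {w})"
  shows "mean S (\<lambda>\<xi>. e \<xi> * avg w h \<xi>) = mean S (\<lambda>\<xi>. e \<xi> * h \<xi>)"
proof -
  have "(\<lambda>\<xi>. e \<xi> * avg w h \<xi>) = mean {w} (\<lambda>\<xi>. e \<xi> * h \<xi>)"
    using mean_factor[OF _ assms(3), of h] by (auto simp: mean_singleton)
  then show ?thesis using assms by (simp add: mean_subset)
qed

lemma mean_variance:
  assumes "finite S"
  shows "mean S (\<lambda>\<xi>. (g \<xi> - mean S g \<xi>)\<^sup>2) \<zeta> = mean S (\<lambda>\<xi>. (g \<xi>)\<^sup>2) \<zeta> - (mean S g \<zeta>)\<^sup>2"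
proof -
  define m where "m = mean S g"
  have m: "depends_only_on m (- S)" unfolding m_def by (rule depends_mean[OF assms])
  have m2: "depends_only_on (\<lambda>\<xi>. (m \<xi>)\<^sup>2) (- S)" "depends_only_on (\<lambda>\<xi>. 2 * m \<xi>) (- S)"
    using depends_only_on_comp[OF m] by auto
  have "(\<lambda>\<xi>. (g \<xi> - m \<xi>)\<^sup>2) = (\<lambda>\<xi>. ((g \<xi>)\<^sup>2 - (2 * m \<xi>) * g \<xi>) + (m \<xi>)\<^sup>2)"
    by (auto simp: power2_eq_square algebra_simps)
  then have "mean S (\<lambda>\<xi>. (g \<xi> - m \<xi>)\<^sup>2) \<zeta>
      = mean S (\<lambda>\<xi>. (g \<xi>)\<^sup>2) \<zeta> - (2 * m \<zeta>) * mean S g \<zeta> + (m \<zeta>)\<^sup>2"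
    by (simp only: mean_add[OF assms] mean_diff[OF assms] mean_factor[OF assms m2(2)]
          mean_indep[OF assms m2(1)])
  then show ?thesis by (simp add: m_def power2_eq_square)
qed

section \<open>A Poincare inequality to the left of a zero\<close>

text \<open>Cauchy-Schwarz against an event of probability \<open>p ^ card S\<close>.\<close>

lemma mean_all_True_square_le:
  assumes "finite S"
  shows "(mean S (\<lambda>\<xi>. of_bool (\<forall>y\<in>S. \<xi> y) * k \<xi>) \<zeta>)\<^sup>2 \<le> p ^ card S * mean S (\<lambda>\<xi>. (k \<xi>)\<^sup>2) \<zeta>"
proof -
  have "(mean S (\<lambda>\<xi>. of_bool (\<forall>y\<in>S. \<xi> y) * k \<xi>) \<zeta>)\<^sup>2
      = p ^ card S * mean S (\<lambda>\<xi>. of_bool (\<forall>y\<in>S. \<xi> y) * (k \<xi>)\<^sup>2) \<zeta>"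
    by (simp only: mean_all_True[OF assms]) (simp add: power2_eq_square)
  also have "\<dots> \<le> p ^ card S * mean S (\<lambda>\<xi>. (k \<xi>)\<^sup>2) \<zeta>"
    using assms p_nonneg by (intro mult_left_mono mean_mono) auto
  finally show ?thesis .
qed

text \<open>The window average \<open>gb\<close> does not see \<open>y\<close>, and neither does the
  probability \<open>p ^ l\<close> of \<open>e\<close>, so their product drops out of the variance
  at \<open>y\<close>. The centred rest \<open>k\<close> gains \<open>p ^ l\<close> by
  Cauchy-Schwarz, and its variance in the window is decomposed once more by
  \<open>variance_telescope\<close>.\<close>

lemma vari_mean_all_True_le:
  fixes l :: nat
  assumes "y + int l < v"
  defines "e \<equiv> \<lambda>\<xi>. of_bool (\<forall>u\<in>{y+1..<y+1+int l}. \<xi> u)"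
  shows "vari y (mean {y+1..<v} (\<lambda>\<xi>. e \<xi> * g \<xi>)) \<zeta>
    \<le> p ^ l * (\<Sum>w\<in>{y..<y+1+int l}. mean {y..<y+1+int l} (vari w (mean {w+1..<v} g)) \<zeta>)"
proof -
  define D U V where "D = {y+1..<y+1+int l}" and "U = {y..<y+1+int l}" and "V = {y+1+int l..<v}"
  have fin: "finite D" "finite U" "finite V" by (auto simp: D_def U_def V_def)
  have U: "U = insert y D" "y \<notin> D" by (auto simp: U_def D_def)
  have R: "{y+1..<v} = D \<union> V" using assms(1) by (auto simp: D_def V_def)
  have card: "card D = l" by (simp add: D_def)
  define g' gb where "g' = mean V g" and "gb = mean U g'"
  define k where "k \<xi> = g' \<xi> - gb \<xi>" for \<xi>
  have eV: "depends_only_on e (- V)"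
    by (auto simp: depends_only_on_def e_def V_def)
  have gb: "depends_only_on gb (- U)"
    unfolding gb_def by (rule depends_mean[OF fin(2)])
  then have gbD: "depends_only_on gb (- D)"
    by (auto simp: depends_only_on_def U)
  have "mean {y+1..<v} (\<lambda>\<xi>. e \<xi> * g \<xi>) = mean D (\<lambda>\<xi>. e \<xi> * g' \<xi>)"
    unfolding R mean_union[OF fin(1,3)] mean_factor[OF fin(3) eV] g'_def ..
  also have "(\<lambda>\<xi>. e \<xi> * g' \<xi>) = (\<lambda>\<xi>. gb \<xi> * e \<xi> + e \<xi> * k \<xi>)"
    by (auto simp: k_def algebra_simps)
  also have "mean D \<dots> = (\<lambda>\<xi>. gb \<xi> * mean D e \<xi> + mean D (\<lambda>\<xi>. e \<xi> * k \<xi>) \<xi>)"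
    unfolding mean_add[OF fin(1)] mean_factor[OF fin(1) gbD] ..
  also have "mean D e = (\<lambda>_. p ^ l)"
    using mean_all_True[OF fin(1), of "\<lambda>_. 1"] by (auto simp: card e_def D_def[symmetric])
  finally have eq: "mean {y+1..<v} (\<lambda>\<xi>. e \<xi> * g \<xi>)
      = (\<lambda>\<xi>. gb \<xi> * p ^ l + mean D (\<lambda>\<xi>. e \<xi> * k \<xi>) \<xi>)" .
  have "gb (\<zeta>(y := b)) = gb \<zeta>" for b
    using gb by (auto simp: depends_only_on_def U)
  then have "vari y (mean {y+1..<v} (\<lambda>\<xi>. e \<xi> * g \<xi>)) \<zeta> = vari y (mean D (\<lambda>\<xi>. e \<xi> * k \<xi>)) \<zeta>"
    by (simp add: eq vari_def)
  also have "\<dots> \<le> mean {y} (\<lambda>\<xi>. (mean D (\<lambda>\<xi>. e \<xi> * k \<xi>) \<xi>)\<^sup>2) \<zeta>"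
    by (simp add: mean_singleton vari_le_avg)
  also have "\<dots> \<le> mean {y} (\<lambda>\<xi>. p ^ l * mean D (\<lambda>\<xi>. (k \<xi>)\<^sup>2) \<xi>) \<zeta>"
    using mean_all_True_square_le[OF fin(1), of k]
    by (intro mean_mono) (auto simp: e_def D_def[symmetric] card)
  also have "\<dots> = p ^ l * mean U (\<lambda>\<xi>. (k \<xi>)\<^sup>2) \<zeta>"
    using fin(1) by (simp add: mean_cmult U mean_insert)
  also have "mean U (\<lambda>\<xi>. (k \<xi>)\<^sup>2) \<zeta> = mean U (\<lambda>\<xi>. (g' \<xi>)\<^sup>2) \<zeta> - (mean U g' \<zeta>)\<^sup>2"
    unfolding k_def gb_def by (rule mean_variance[OF fin(2)])
  also have "\<dots> = (\<Sum>w\<in>U. mean U (vari w (mean {w+1..<y+1+int l} g')) \<zeta>)"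
    unfolding U_def by (rule variance_telescope) simp
  also have "\<dots> = (\<Sum>w\<in>U. mean U (vari w (mean {w+1..<v} g)) \<zeta>)"
  proof (rule sum.cong[OF refl])
    fix w assume "w \<in> U"
    then have "{w+1..<v} = {w+1..<y+1+int l} \<union> V" using assms(1) by (auto simp: U_def V_def)
    then have "mean {w+1..<y+1+int l} g' = mean {w+1..<v} g"
      by (simp add: g'_def mean_union fin)
    then show "mean U (vari w (mean {w+1..<y+1+int l} g')) \<zeta> = mean U (vari w (mean {w+1..<v} g)) \<zeta>"
      by simp
  qed
  finally show ?thesis by (simp only: U_def)
qed

text \<open>The sites are revealed from left to right, so that the constraint at \<open>y\<close>, which looks to the
  right, is averaged out in the increment at \<open>y\<close>.  The part of \<open>g\<close> on which the constraint fails then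
  costs a factor \<open>p ^ l\<close> and only variance from the window \<open>{y..y + l}\<close>.\<close>

lemma long_range_poincare:
  assumes av: "a \<le> v" and zv: "\<not> \<zeta> v" and l: "4 * (p ^ l * (real l + 1)) \<le> 1" "0 < l"
  shows "mean {a..<v} (\<lambda>\<xi>. (g \<xi>)\<^sup>2) \<zeta> - (mean {a..<v} g \<zeta>)\<^sup>2
    \<le> 4 * (\<Sum>y\<in>{a..<v}. mean {a..<v}
        (\<lambda>\<xi>. of_bool (\<exists>u\<in>{y+1..<y+1+int l}. \<not> \<xi> u) * vari y g \<xi>) \<zeta>)"
proof -
  define S where "S = {a..<v}"
  define T where "T y = mean S (vari y (mean {y+1..<v} g)) \<zeta>" for y
  define c :: "int \<Rightarrow> config \<Rightarrow> real" where "c y \<xi> = of_bool (\<exists>u\<in>{y+1..<y+1+int l}. \<not> \<xi> u)" for y \<xi>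
  define e :: "int \<Rightarrow> config \<Rightarrow> real" where "e y \<xi> = of_bool (\<forall>u\<in>{y+1..<y+1+int l}. \<xi> u)" for y \<xi>
  define Q where "Q y = mean S (\<lambda>\<xi>. c y \<xi> * vari y g \<xi>) \<zeta>" for y
  have fin: "finite S" by (simp add: S_def)
  have T0: "0 \<le> T y" for y
    unfolding T_def by (intro mean_nonneg fin vari_nonneg)
  have key: "T y \<le> 2 * Q y + 2 * p ^ l * (\<Sum>w\<in>{w\<in>S. y \<le> w \<and> w \<le> y + int l}. T w)"
    if y: "y \<in> S" for y
  proof -
    define R where "R = {y+1..<v}"
    have R: "finite R" "y \<notin> R" "R \<subseteq> S" using y by (auto simp: R_def S_def)
    \<comment> \<open>Either the relaxed constraint \<open>c\<close> holds, with a zero at distance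
      at most \<open>l\<close> to the right of \<open>y\<close>, or all these sites are occupied and
      \<open>e\<close> holds.\<close>
    have "(\<lambda>\<xi>. c y \<xi> * g \<xi> + e y \<xi> * g \<xi>) = g" by (auto simp: c_def e_def)
    then have split: "mean R g
        = (\<lambda>\<xi>. mean R (\<lambda>\<xi>. c y \<xi> * g \<xi>) \<xi> + mean R (\<lambda>\<xi>. e y \<xi> * g \<xi>) \<xi>)"
      using mean_add[OF R(1), of "\<lambda>\<xi>. c y \<xi> * g \<xi>" "\<lambda>\<xi>. e y \<xi> * g \<xi>"] by simp
    have c: "depends_only_on (c y) (- {y})" "(c y \<xi>)\<^sup>2 = c y \<xi>" for \<xi>
      by (auto simp: depends_only_on_def c_def)
    then have "vari y (\<lambda>\<xi>. c y \<xi> * g \<xi>) = (\<lambda>\<xi>. c y \<xi> * vari y g \<xi>)"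
      by (intro ext) (simp only: vari_factor)
    then have c_le: "vari y (mean R (\<lambda>\<xi>. c y \<xi> * g \<xi>)) \<xi> \<le> mean R (\<lambda>\<xi>. c y \<xi> * vari y g \<xi>) \<xi>" for \<xi>
      using vari_mean_le[OF R(1,2), of "\<lambda>\<xi>. c y \<xi> * g \<xi>" \<xi>] by simp
    define E where "E = mean S (vari y (mean R (\<lambda>\<xi>. e y \<xi> * g \<xi>))) \<zeta>"
    have "T y \<le> mean S (\<lambda>\<xi>. 2 * mean R (\<lambda>\<xi>. c y \<xi> * vari y g \<xi>) \<xi>
        + 2 * vari y (mean R (\<lambda>\<xi>. e y \<xi> * g \<xi>)) \<xi>) \<zeta>"
      unfolding T_def R_def[symmetric]
    proof (rule mean_mono[OF fin])
      fix \<xi>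
      show "vari y (mean R g) \<xi> \<le> 2 * mean R (\<lambda>\<xi>. c y \<xi> * vari y g \<xi>) \<xi>
        + 2 * vari y (mean R (\<lambda>\<xi>. e y \<xi> * g \<xi>)) \<xi>"
        using vari_add_le[of y "mean R (\<lambda>\<xi>. c y \<xi> * g \<xi>)" "mean R (\<lambda>\<xi>. e y \<xi> * g \<xi>)" \<xi>] c_le[of \<xi>]
        by (simp add: split[symmetric])
    qed
    also have "\<dots> = 2 * Q y + 2 * E"
      by (simp add: mean_add[OF fin] mean_cmult[OF fin] mean_subset[OF fin R(3)] Q_def E_def)
    also have "E \<le> p ^ l * (\<Sum>w\<in>{w\<in>S. y \<le> w \<and> w \<le> y + int l}. T w)"
    proof (cases "y + int l < v")
      case True
      define U where "U = {y..<y+1+int l}"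
      have U: "U = {w\<in>S. y \<le> w \<and> w \<le> y + int l}" "U \<subseteq> S"
        using True y by (auto simp: U_def S_def)
      have "E \<le> mean S (\<lambda>\<xi>. p ^ l * (\<Sum>w\<in>U. mean U (vari w (mean {w+1..<v} g)) \<xi>)) \<zeta>"
        unfolding E_def R_def e_def U_def
        by (intro mean_mono fin vari_mean_all_True_le True)
      also have "\<dots> = p ^ l * (\<Sum>w\<in>U. T w)"
        by (simp add: mean_cmult[OF fin] mean_sum[OF fin] mean_subset[OF fin U(2)] T_def)
      finally show ?thesis by (simp only: U)
    next
      case False
      \<comment> \<open>Here the window reaches \<open>v\<close>, which is empty, so
        \<open>e\<close> cannot hold and this part vanishes.\<close>
      have "mean R (\<lambda>\<xi>. e y \<xi> * g \<xi>) \<xi> = 0" if "\<not> \<xi> v" for \<xi>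
      proof -
        have "mean R (\<lambda>\<xi>. e y \<xi> * g \<xi>) \<xi> = mean R (\<lambda>_. 0) \<xi>"
        proof (rule mean_cong[OF R(1)])
          fix \<xi>' assume "\<And>u. u \<notin> R \<Longrightarrow> \<xi>' u = \<xi> u"
          then have "\<not> \<xi>' v" using that by (auto simp: R_def)
          moreover have "v \<in> {y+1..<y+1+int l}" using y False by (auto simp: S_def)
          ultimately show "e y \<xi>' * g \<xi>' = 0" by (auto simp: e_def)
        qed
        then show ?thesis by (simp add: R)
      qed
      then have "vari y (mean R (\<lambda>\<xi>. e y \<xi> * g \<xi>)) \<xi> = 0" if "\<not> \<xi> v" for \<xi>
        using that y by (auto simp: vari_def S_def)
      then have "E = mean S (\<lambda>_. 0) \<zeta>"
        unfolding E_def using zv by (intro mean_cong[OF fin]) (auto simp: S_def)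
      also have "\<dots> = 0" by (simp add: fin)
      also have "0 \<le> p ^ l * (\<Sum>w\<in>{w\<in>S. y \<le> w \<and> w \<le> y + int l}. T w)"
        using p_nonneg T0 by (intro mult_nonneg_nonneg sum_nonneg) auto
      finally show ?thesis .
    qed
    finally show ?thesis by simp
  qed
  have "(\<Sum>y\<in>S. T y)
      \<le> (\<Sum>y\<in>S. 2 * Q y + 2 * p ^ l * (\<Sum>w\<in>{w\<in>S. y \<le> w \<and> w \<le> y + int l}. T w))"
    by (intro sum_mono key)
  also have "\<dots> = 2 * (\<Sum>y\<in>S. Q y)
      + 2 * p ^ l * (\<Sum>y\<in>S. \<Sum>w\<in>{w\<in>S. y \<le> w \<and> w \<le> y + int l}. T w)"
    by (simp add: sum.distrib sum_distrib_left)
  also have "\<dots> \<le> 2 * (\<Sum>y\<in>S. Q y) + 2 * p ^ l * ((real l + 1) * (\<Sum>w\<in>S. T w))"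
    using p_nonneg by (intro add_left_mono mult_left_mono window_sum_le fin T0) auto
  finally have "(\<Sum>y\<in>S. T y) \<le> 2 * (\<Sum>y\<in>S. Q y) + (2 * (p ^ l * (real l + 1))) * (\<Sum>w\<in>S. T w)"
    by (simp add: mult.assoc)
  \<comment> \<open>The choice of \<open>l\<close> leaves at most half of the sum of
    \<open>T\<close> on the right, where it can be absorbed.\<close>
  also have "\<dots> \<le> 2 * (\<Sum>y\<in>S. Q y) + (1 / 2) * (\<Sum>w\<in>S. T w)"
    using l T0 by (intro add_left_mono mult_right_mono sum_nonneg) auto
  finally have "(\<Sum>y\<in>S. T y) \<le> 4 * (\<Sum>y\<in>S. Q y)" by simp
  then show ?thesis
    using variance_telescope[OF av, of g \<zeta>] by (simp add: T_def Q_def S_def c_def)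
qed

text \<open>A two-site computation: the difference at \<open>y\<close> with \<open>u\<close>
  occupied equals the one with \<open>u\<close> empty, corrected by two differences at
  \<open>u\<close>.\<close>

lemma avg_vari_le:
  assumes "u \<noteq> y"
  shows "avg u (vari y g) \<zeta>
    \<le> 2 / (1 - p) * (avg u (\<lambda>\<xi>. of_bool (\<not> \<xi> u) * vari y g \<xi>) \<zeta> + avg y (vari u g) \<zeta>)"
proof -
  define q where "q = 1 - p"
  have q: "0 < q" "q \<le> 1" "p = 1 - q" using p_nonneg p_less_1 by (auto simp: q_def)
  define g1 where "g1 b c = g (\<zeta>(u := b, y := c))" for b c
  have tw: "g (\<zeta>(y := c, u := b)) = g1 b c" for b c
    using assms by (simp add: g1_def fun_upd_twist)
  define x s t where "x = g1 False True - g1 False False" and "s = g1 True True - g1 False True"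
    and "t = g1 True False - g1 False False"
  have xst: "g1 True True - g1 True False = x + s - t" by (simp add: x_def s_def t_def)
  have eqs: "avg u (vari y g) \<zeta> = p * q * (p * (x + s - t)\<^sup>2 + q * x\<^sup>2)"
    "avg u (\<lambda>\<xi>. of_bool (\<not> \<xi> u) * vari y g \<xi>) \<zeta> = p * q * (q * x\<^sup>2)"
    "avg y (vari u g) \<zeta> = p * q * (p * s\<^sup>2 + q * t\<^sup>2)"
    unfolding avg_def vari_def q_def[symmetric] tw xst[symmetric]
    using assms
    by (simp_all add: tw g1_def[symmetric] x_def s_def t_def algebra_simps)
  \<comment> \<open>The parallelogram law for \<open>x\<close> and \<open>s - t\<close>, combined
    with \<open>p * s\<^sup>2 + q * t\<^sup>2 = (p * s + q * t)\<^sup>2 + p * q * (s -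
    t)\<^sup>2\<close>. All terms added on the left are nonnegative, the last because
    \<open>2 - 2 * p - q = q\<close>.\<close>
  have "q * (p * (x + s - t)\<^sup>2 + q * x\<^sup>2) + p * q * (x - (s - t))\<^sup>2 + 2 * (p * s + q * t)\<^sup>2
      + q * (2 - 2 * p - q) * x\<^sup>2 = 2 * (q * x\<^sup>2 + (p * s\<^sup>2 + q * t\<^sup>2))"
    by (simp add: q(3) power2_eq_square algebra_simps)
  moreover have "0 \<le> p * q * (x - (s - t))\<^sup>2" "0 \<le> 2 * (p * s + q * t)\<^sup>2" "0 \<le> q * (2 - 2 * p - q) * x\<^sup>2"
    using q p_nonneg by auto
  ultimately have "p * (q * (p * (x + s - t)\<^sup>2 + q * x\<^sup>2)) \<le> p * (2 * (q * x\<^sup>2 + (p * s\<^sup>2 + q * t\<^sup>2)))"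
    using p_nonneg by (intro mult_left_mono) linarith
  also have "\<dots> = 2 / q * (p * q * (q * x\<^sup>2 + (p * s\<^sup>2 + q * t\<^sup>2)))"
    using q(1) by simp
  finally have "p * q * (p * (x + s - t)\<^sup>2 + q * x\<^sup>2) \<le> 2 / q * (p * q * (q * x\<^sup>2 + (p * s\<^sup>2 + q * t\<^sup>2)))"
    by (simp add: mult.assoc)
  then show ?thesis
    unfolding eqs q_def[symmetric] by (simp add: algebra_simps)
qed

text \<open>To resample \<open>y\<close> with the help of a zero at distance \<open>k + 1\<close>, first create a zero at distance
  \<open>k\<close>.\<close>

lemma vacancy_transport:
  assumes "a \<le> y" "y + int (Suc k) \<le> v"
  shows "mean {a..<v} (\<lambda>\<xi>. of_bool (\<not> \<xi> (y + int (Suc k))) * vari y g \<xi>) \<zeta>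
    \<le> (4 / (1 - p)) ^ k * (\<Sum>w\<in>{y..<y + int (Suc k)}.
        mean {a..<v} (\<lambda>\<xi>. of_bool (\<not> \<xi> (w + 1)) * vari w g \<xi>) \<zeta>)"
  using assms(2)
proof (induction k)
  case 0
  have "{y..<y + 1} = {y}" by auto
  then show ?case by simp
next
  case (Suc k)
  define S where "S = {a..<v}"
  define A where "A = 4 / (1 - p)"
  define D where "D w = mean S (\<lambda>\<xi>. of_bool (\<not> \<xi> (w + 1)) * vari w g \<xi>) \<zeta>" for w
  define u where "u = y + int (Suc k)"
  have fin: "finite S" by (simp add: S_def)
  have u: "u \<in> S" "y \<in> S" "u \<noteq> y" "y + int (Suc (Suc k)) = u + 1" "u \<noteq> u + 1" "y \<noteq> u + 1"
    using Suc.prems assms(1) by (auto simp: S_def u_def)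
  have A: "1 \<le> A" using p_nonneg p_less_1 by (simp add: A_def)
  have D0: "0 \<le> D w" for w
    unfolding D_def by (intro mean_nonneg fin mult_nonneg_nonneg vari_nonneg) auto
  define e :: "config \<Rightarrow> real" where "e \<xi> = of_bool (\<not> \<xi> (u + 1))" for \<xi>
  have e: "depends_only_on e (- {w})" if "w \<noteq> u + 1" for w
    using that by (auto simp: depends_only_on_def e_def)
  \<comment> \<open>The constraint \<open>e\<close> looks at \<open>u + 1\<close> only, so
    resamplings of \<open>u\<close> and of \<open>y\<close> may be inserted or removed under the
    average.\<close>
  note pull = mean_factor_avg[OF fin _ e]
  have "mean S (\<lambda>\<xi>. e \<xi> * vari y g \<xi>) \<zeta> = mean S (\<lambda>\<xi>. e \<xi> * avg u (vari y g) \<xi>) \<zeta>"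
    using u by (simp add: pull)
  also have "\<dots> \<le> mean S (\<lambda>\<xi>. A / 2 * (e \<xi> * avg u (\<lambda>\<xi>. of_bool (\<not> \<xi> u) * vari y g \<xi>) \<xi>
      + e \<xi> * avg y (vari u g) \<xi>)) \<zeta>"
  proof (rule mean_mono[OF fin])
    fix \<xi>
    have A2: "A / 2 = 2 / (1 - p)" using p_less_1 by (simp add: A_def field_simps)
    have "avg u (vari y g) \<xi> \<le> A / 2 * (avg u (\<lambda>\<xi>. of_bool (\<not> \<xi> u) * vari y g \<xi>) \<xi>
      + avg y (vari u g) \<xi>)"
      unfolding A2 by (rule avg_vari_le[OF u(3)])
    then show "e \<xi> * avg u (vari y g) \<xi> \<le> A / 2 * (e \<xi> * avg u (\<lambda>\<xi>. of_bool (\<not> \<xi> u) * vari y g \<xi>) \<xi>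
      + e \<xi> * avg y (vari u g) \<xi>)"
      by (simp add: e_def)
  qed
  also have "\<dots> = A / 2 * (mean S (\<lambda>\<xi>. e \<xi> * (of_bool (\<not> \<xi> u) * vari y g \<xi>)) \<zeta>
      + mean S (\<lambda>\<xi>. e \<xi> * vari u g \<xi>) \<zeta>)"
    using u by (simp only: mean_cmult[OF fin] mean_add[OF fin] pull not_False_eq_True)
  also have "\<dots> \<le> A / 2 * (A ^ k * (\<Sum>w\<in>{y..<u}. D w) + D u)"
  proof (intro mult_left_mono add_mono)
    \<comment> \<open>Forgetting the zero at \<open>u + 1\<close> leaves the same quantity with a
      zero at \<open>u\<close>, one step closer to \<open>y\<close>.\<close>
    have "mean S (\<lambda>\<xi>. e \<xi> * (of_bool (\<not> \<xi> u) * vari y g \<xi>)) \<zeta>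
        \<le> mean S (\<lambda>\<xi>. of_bool (\<not> \<xi> u) * vari y g \<xi>) \<zeta>"
      using vari_nonneg by (intro mean_mono fin) (auto simp: e_def)
    also have "\<dots> \<le> A ^ k * (\<Sum>w\<in>{y..<u}. D w)"
      using Suc by (simp add: S_def A_def D_def u_def)
    finally show "mean S (\<lambda>\<xi>. e \<xi> * (of_bool (\<not> \<xi> u) * vari y g \<xi>)) \<zeta>
        \<le> A ^ k * (\<Sum>w\<in>{y..<u}. D w)" .
  qed (use A in \<open>auto simp: D_def e_def\<close>)
  also have "\<dots> \<le> A * (A ^ k * (\<Sum>w\<in>{y..<u}. D w) + A ^ k * D u)"
    using A D0 mult_right_mono[OF one_le_power[OF A, of k] D0, of u]
    by (intro mult_mono add_left_mono add_nonneg_nonneg mult_nonneg_nonneg sum_nonneg) auto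
  also have "\<dots> = A ^ Suc k * (\<Sum>w\<in>insert u {y..<u}. D w)"
    by (simp add: algebra_simps)
  also have "insert u {y..<u} = {y..<u + 1}" by (auto simp: u_def)
  finally show ?case unfolding u(4) by (simp only: e_def S_def A_def D_def)
qed

lemma vacancy_weight_exists:
  "\<exists>l>0. 4 * (p ^ l * (real l + 1)) \<le> 1"
proof -
  have p: "norm p < 1" using p_nonneg p_less_1 by simp
  have "(\<lambda>n. 4 * (real n * p ^ n + p ^ n)) \<longlonglongrightarrow> 4 * (0 + 0)"
    using powser_times_n_limit_0[OF p] LIMSEQ_power_zero[OF p] by (intro tendsto_mult tendsto_add tendsto_const)
  then have "eventually (\<lambda>n. 4 * (real n * p ^ n + p ^ n) < 1) sequentially"
    by (rule order_tendstoD(2)) simp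
  then obtain N where "\<And>n. n \<ge> N \<Longrightarrow> 4 * (real n * p ^ n + p ^ n) < 1"
    unfolding eventually_sequentially by blast
  from this[of "Suc N"] show ?thesis
    by (intro exI[of _ "Suc N"]) (simp add: algebra_simps)
qed

text \<open>A zero within distance \<open>l\<close> is summed over its possible positions, and
  \<open>vacancy_transport\<close> trades each of them for true constraints. All constants come from
  \<open>p\<close> and from an \<open>l\<close> chosen from \<open>p\<close>, hence the uniformity
  in \<open>a\<close> and \<open>v\<close>.\<close>

lemma east_poincare:
  "\<exists>\<gamma>>0. \<forall>a v \<zeta> g. a \<le> v \<longrightarrow> \<not> \<zeta> v \<longrightarrow>
     \<gamma> * (mean {a..<v} (\<lambda>\<xi>. (g \<xi>)\<^sup>2) \<zeta> - (mean {a..<v} g \<zeta>)\<^sup>2)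
     \<le> (\<Sum>y\<in>{a..<v}. mean {a..<v} (\<lambda>\<xi>. of_bool (\<not> \<xi> (y + 1)) * vari y g \<xi>) \<zeta>)"
proof -
  obtain l where l: "0 < l" "4 * (p ^ l * (real l + 1)) \<le> 1"
    using vacancy_weight_exists by blast
  define A where "A = 4 / (1 - p)"
  have A: "1 \<le> A" using p_nonneg p_less_1 by (simp add: A_def)
  \<comment> \<open>4 from the relaxed inequality, \<open>l\<close> positions of the zero,
    \<open>A ^ l\<close> for the transport and \<open>l + 1\<close> for the overlap of the windows;
    \<gamma> will be \<open>1 / K\<close>.\<close>
  define K where "K = 4 * (real l * A ^ l * (real l + 1))"
  have K: "0 < K" using A l by (auto simp: K_def intro!: mult_pos_pos)
  have "mean {a..<v} (\<lambda>\<xi>. (g \<xi>)\<^sup>2) \<zeta> - (mean {a..<v} g \<zeta>)\<^sup>2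
     \<le> K * (\<Sum>y\<in>{a..<v}. mean {a..<v} (\<lambda>\<xi>. of_bool (\<not> \<xi> (y + 1)) * vari y g \<xi>) \<zeta>)"
    if av: "a \<le> v" and zv: "\<not> \<zeta> v" for a v \<zeta> g
  proof -
    define S where "S = {a..<v}"
    define D where "D w = mean S (\<lambda>\<xi>. of_bool (\<not> \<xi> (w + 1)) * vari w g \<xi>) \<zeta>" for w
    have fin: "finite S" by (simp add: S_def)
    have D0: "0 \<le> D w" for w
      unfolding D_def by (intro mean_nonneg fin mult_nonneg_nonneg vari_nonneg) auto
    have near: "mean S (\<lambda>\<xi>. of_bool (\<exists>u\<in>{y+1..<y+1+int l}. \<not> \<xi> u) * vari y g \<xi>) \<zeta>
        \<le> real l * A ^ l * (\<Sum>w\<in>{w\<in>S. y \<le> w \<and> w \<le> y + int l}. D w)"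
      if y: "y \<in> S" for y
    proof -
      define I where "I = {k. k < l \<and> y + int (Suc k) \<le> v}"
      have I: "finite I" "card I \<le> l"
        using card_mono[of "{..<l}" I] by (auto simp: I_def)
      have "mean S (\<lambda>\<xi>. of_bool (\<exists>u\<in>{y+1..<y+1+int l}. \<not> \<xi> u) * vari y g \<xi>) \<zeta>
          \<le> mean S (\<lambda>\<xi>. \<Sum>k\<in>I. of_bool (\<not> \<xi> (y + int (Suc k))) * vari y g \<xi>) \<zeta>"
      proof (rule mean_mono[OF fin])
        fix \<xi> assume "\<And>w. w \<notin> S \<Longrightarrow> \<xi> w = \<zeta> w"
        then have xv: "\<not> \<xi> v" using zv by (simp add: S_def)
        show "of_bool (\<exists>u\<in>{y+1..<y+1+int l}. \<not> \<xi> u) * vari y g \<xi>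
            \<le> (\<Sum>k\<in>I. of_bool (\<not> \<xi> (y + int (Suc k))) * vari y g \<xi>)"
        proof (cases "\<exists>u\<in>{y+1..<y+1+int l}. \<not> \<xi> u")
          case True
          then obtain u where u: "u \<in> {y+1..<y+1+int l}" "\<not> \<xi> u" by blast
          \<comment> \<open>A zero found beyond \<open>v\<close> is replaced by \<open>v\<close>
            itself, which is empty and within reach of the transport inside
            \<open>{a..<v}\<close>.\<close>
          define k where "k = nat (min u v - y - 1)"
          have "y < v" using y by (simp add: S_def)
          then have k: "k \<in> I" "y + int (Suc k) = min u v"
            using u(1) by (auto simp: k_def I_def)
          have "\<not> \<xi> (min u v)" using u(2) xv by (simp add: min_def)
          then have "vari y g \<xi> = of_bool (\<not> \<xi> (y + int (Suc k))) * vari y g \<xi>"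
            by (simp only: k(2)) simp
          also have "\<dots> \<le> (\<Sum>k\<in>I. of_bool (\<not> \<xi> (y + int (Suc k))) * vari y g \<xi>)"
            using vari_nonneg by (intro member_le_sum I k(1)) auto
          finally show ?thesis using True by simp
        next
          case False
          then show ?thesis using vari_nonneg by (auto intro!: sum_nonneg)
        qed
      qed
      also have "\<dots> = (\<Sum>k\<in>I. mean S (\<lambda>\<xi>. of_bool (\<not> \<xi> (y + int (Suc k))) * vari y g \<xi>) \<zeta>)"
        by (simp only: mean_sum[OF fin])
      also have "\<dots> \<le> (\<Sum>k\<in>I. A ^ l * (\<Sum>w\<in>{w\<in>S. y \<le> w \<and> w \<le> y + int l}. D w))"
      proof (rule sum_mono)
        fix k assume k: "k \<in> I"
        have "mean S (\<lambda>\<xi>. of_bool (\<not> \<xi> (y + int (Suc k))) * vari y g \<xi>) \<zeta>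
            \<le> A ^ k * (\<Sum>w\<in>{y..<y + int (Suc k)}. D w)"
          unfolding S_def A_def D_def using k y
          by (intro vacancy_transport) (auto simp: I_def S_def)
        also have "\<dots> \<le> A ^ l * (\<Sum>w\<in>{w\<in>S. y \<le> w \<and> w \<le> y + int l}. D w)"
          using k y A D0 fin
          by (intro mult_mono power_increasing sum_mono2 sum_nonneg) (auto simp: I_def S_def)
        finally show "mean S (\<lambda>\<xi>. of_bool (\<not> \<xi> (y + int (Suc k))) * vari y g \<xi>) \<zeta>
            \<le> A ^ l * (\<Sum>w\<in>{w\<in>S. y \<le> w \<and> w \<le> y + int l}. D w)" .
      qed
      also have "\<dots> \<le> real l * (A ^ l * (\<Sum>w\<in>{w\<in>S. y \<le> w \<and> w \<le> y + int l}. D w))"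
        using I A D0 by (auto intro!: mult_right_mono mult_nonneg_nonneg sum_nonneg)
      finally show ?thesis by (simp add: mult.assoc)
    qed
    have "mean S (\<lambda>\<xi>. (g \<xi>)\<^sup>2) \<zeta> - (mean S g \<zeta>)\<^sup>2
      \<le> 4 * (\<Sum>y\<in>S. mean S (\<lambda>\<xi>. of_bool (\<exists>u\<in>{y+1..<y+1+int l}. \<not> \<xi> u) * vari y g \<xi>) \<zeta>)"
      unfolding S_def using av zv l by (intro long_range_poincare)
    also have "\<dots> \<le> 4 * (\<Sum>y\<in>S. real l * A ^ l * (\<Sum>w\<in>{w\<in>S. y \<le> w \<and> w \<le> y + int l}. D w))"
      using near by (intro mult_left_mono sum_mono) auto
    also have "\<dots> = 4 * (real l * A ^ l * (\<Sum>y\<in>S. \<Sum>w\<in>{w\<in>S. y \<le> w \<and> w \<le> y + int l}. D w))"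
      by (simp only: sum_distrib_left)
    also have "\<dots> \<le> 4 * (real l * A ^ l * ((real l + 1) * (\<Sum>w\<in>S. D w)))"
      using A by (intro mult_left_mono window_sum_le fin D0) auto
    finally show ?thesis by (simp add: K_def S_def D_def mult.assoc)
  qed
  then show ?thesis
    using K by (intro exI[of _ "1 / K"]) (auto simp: field_simps)
qed

section \<open>The distinguished zero along the Euler scheme\<close>

text \<open>One explicit Euler step of mesh \<open>h\<close>.  Spins outside \<open>{a..<R}\<close> are frozen: sites left of \<open>a\<close>
  never matter, and a distinguished zero that reaches \<open>R\<close> stays there.\<close>

definition euler :: "real \<Rightarrow> int \<Rightarrow> int \<Rightarrow> (config \<Rightarrow> real) \<Rightarrow> config \<Rightarrow> real" where
  "euler h a R g \<xi> = g \<xi> + h * (\<Sum>x\<in>{a..<R}. of_bool (\<not> \<xi> (x + 1)) * (avg x g \<xi> - g \<xi>))"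

text \<open>For \<open>h * (R - a) \<le> 1\<close> all weights are nonnegative and add up to 1, so
  the step is an averaging operator; this is the source of its stability.\<close>

lemma euler_convex:
  "euler h a R g \<xi> = (1 - h * (\<Sum>x\<in>{a..<R}. of_bool (\<not> \<xi> (x + 1)))) * g \<xi>
     + h * (\<Sum>x\<in>{a..<R}. of_bool (\<not> \<xi> (x + 1)) * avg x g \<xi>)"
  by (simp add: euler_def algebra_simps sum_subtractf sum_distrib_left del: sum_of_bool_eq)

lemma abs_avg_le: "\<bar>g (\<xi>(x := True))\<bar> \<le> B \<Longrightarrow> \<bar>g (\<xi>(x := False))\<bar> \<le> B \<Longrightarrow> \<bar>avg x g \<xi>\<bar> \<le> B"
proof -
  assume *: "\<bar>g (\<xi>(x := True))\<bar> \<le> B" "\<bar>g (\<xi>(x := False))\<bar> \<le> B"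
  have "\<bar>avg x g \<xi>\<bar> \<le> p * \<bar>g (\<xi>(x := True))\<bar> + (1 - p) * \<bar>g (\<xi>(x := False))\<bar>"
    unfolding avg_def using p_nonneg p_less_1
    by (intro order.trans[OF abs_triangle_ineq]) (simp add: abs_mult)
  also have "\<dots> \<le> p * B + (1 - p) * B"
    using * p_nonneg p_less_1 by (intro add_mono mult_left_mono) auto
  finally show ?thesis by (simp add: algebra_simps)
qed

lemma vacancy_sum_le:
  fixes h :: real and c :: "int \<Rightarrow> bool"
  assumes "0 \<le> h" "I \<subseteq> {a..<R}" "a \<le> R"
  shows "h * (\<Sum>x\<in>I. of_bool (c x)) \<le> h * (R - a)"
proof -
  have "(\<Sum>x\<in>I. of_bool (c x) :: real) \<le> (\<Sum>x\<in>I. 1)"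
    by (intro sum_mono) auto
  also have "\<dots> \<le> (\<Sum>x\<in>{a..<R}. 1)"
    using assms by (intro sum_mono2) auto
  also have "\<dots> = R - a" using assms by simp
  finally show ?thesis using assms(1) by (rule mult_left_mono)
qed

lemma euler_bounded:
  assumes h: "0 \<le> h" "h * (R - a) \<le> 1" and "a \<le> R" and B: "\<And>\<xi>. \<bar>g \<xi>\<bar> \<le> B"
  shows "\<bar>euler h a R g \<xi>\<bar> \<le> B"
proof -
  define K :: real where "K = (\<Sum>x\<in>{a..<R}. of_bool (\<not> \<xi> (x + 1)))"
  have K: "0 \<le> K" "h * K \<le> 1"
    using vacancy_sum_le[OF h(1), of "{a..<R}" a R "\<lambda>x. \<not> \<xi> (x + 1)"] h(2) \<open>a \<le> R\<close>
    unfolding K_def by (auto intro!: sum_nonneg simp del: sum_of_bool_eq)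
  have "\<bar>\<Sum>x\<in>{a..<R}. of_bool (\<not> \<xi> (x + 1)) * avg x g \<xi>\<bar>
      \<le> (\<Sum>x\<in>{a..<R}. of_bool (\<not> \<xi> (x + 1)) * B)"
    using B abs_avg_le[of g \<xi> _ B] by (intro order.trans[OF sum_abs] sum_mono) (auto simp: abs_mult)
  also have "\<dots> = K * B" by (simp only: K_def sum_distrib_right)
  finally have 1: "\<bar>h * (\<Sum>x\<in>{a..<R}. of_bool (\<not> \<xi> (x + 1)) * avg x g \<xi>)\<bar> \<le> h * (K * B)"
    using h(1) by (simp add: abs_mult mult_left_mono)
  have 2: "\<bar>(1 - h * K) * g \<xi>\<bar> \<le> (1 - h * K) * B"
    using K B[of \<xi>] by (simp add: abs_mult mult_left_mono)
  have "\<bar>euler h a R g \<xi>\<bar> \<le> (1 - h * K) * B + h * (K * B)"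
    unfolding euler_convex K_def[symmetric]
    by (rule order.trans[OF abs_triangle_ineq add_mono[OF 2 1]])
  then show ?thesis by (simp add: algebra_simps)
qed

lemma depends_only_on_avg:
  assumes "depends_only_on g A"
  shows "depends_only_on (avg x g) A"
  unfolding depends_only_on_def
proof (intro allI impI)
  fix \<xi> \<xi>' :: config assume *: "\<forall>x\<in>A. \<xi> x = \<xi>' x"
  have "g (\<xi>(x := b)) = g (\<xi>'(x := b))" for b
    by (rule assms[unfolded depends_only_on_def, rule_format]) (use * in auto)
  then show "avg x g \<xi> = avg x g \<xi>'" by (simp add: avg_def)
qed

lemma depends_only_on_euler:
  assumes "depends_only_on g {a..R}"
  shows "depends_only_on (euler h a R g) {a..R}"
  unfolding depends_only_on_def
proof (intro allI impI)
  fix \<xi> \<xi>' :: config assume *: "\<forall>x\<in>{a..R}. \<xi> x = \<xi>' x"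
  have "g \<xi> = g \<xi>'" "avg x g \<xi> = avg x g \<xi>'" for x
    using assms depends_only_on_avg[OF assms, of x] * by (auto simp: depends_only_on_def)
  moreover have "of_bool (\<not> \<xi> (x + 1)) = (of_bool (\<not> \<xi>' (x + 1)) :: real)" if "x \<in> {a..<R}" for x
    using * that by auto
  ultimately show "euler h a R g \<xi> = euler h a R g \<xi>'"
    unfolding euler_def by (intro arg_cong2[where f = "(+)"] arg_cong2[where f = "(*)"] sum.cong) auto
qed

section \<open>Averages to the left of a distinguished zero under an Euler step\<close>

lemma mean_avg_commute: "finite S \<Longrightarrow> mean S (avg y g) = avg y (mean S g)"
  by (metis mean_avg mean_insert)

lemma depends_vacancy: "w \<notin> A \<Longrightarrow> depends_only_on (\<lambda>\<xi>. of_bool (\<not> \<xi> w)) (- A)"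
  by (auto simp: depends_only_on_def)

text \<open>The site \<open>x\<close> plays the role of the distinguished zero: after a legal ring at \<open>x\<close> the site
  \<open>x + 1\<close> is empty and takes over.\<close>

lemma euler_mean_zero:
  assumes "a \<le> b"
    and g: "\<And>x \<xi>. b < x \<Longrightarrow> x \<le> R \<Longrightarrow> \<not> \<xi> x \<Longrightarrow> mean {a..<x} g \<xi> = 0"
    and x: "b < x" "x \<le> R" "\<not> \<xi> x"
  shows "mean {a..<x} (euler h a R g) \<xi> = 0"
proof -
  define S where "S = {a..<x}"
  have fin: "finite S" by (simp add: S_def)
  have zero: "mean S (\<lambda>\<xi>. of_bool (\<not> \<xi> (y + 1)) * (avg y g \<xi> - g \<xi>)) \<xi> = 0" if y: "y \<in> {a..<R}" for y
  proof (cases "y \<in> S")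
    case True
    \<comment> \<open>A ring inside the averaged interval is invisible, as its constraint does not
      look at \<open>y\<close>.\<close>
    have "depends_only_on (\<lambda>\<xi>. of_bool (\<not> \<xi> (y + 1))) (- {y})"
      by (rule depends_vacancy) simp
    from mean_factor_avg[OF fin True this]
    show ?thesis by (simp add: right_diff_distrib mean_diff[OF fin])
  next
    case False
    then have yx: "x \<le> y" using y by (simp add: S_def)
    have S0: "mean S g \<zeta> = 0" if "\<not> \<zeta> x" for \<zeta>
      using g[of x] x that by (simp add: S_def)
    have "mean S (avg y g) \<xi> = 0" if "\<not> \<xi> (y + 1)"
    proof (cases "y = x")
      case True
      have "insert x S = {a..<x + 1}" using assms(1) x by (auto simp: S_def)
      then show ?thesis using that True y x g[of "x + 1" \<xi>] by (simp add: mean_avg[OF fin])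
    next
      case False
      \<comment> \<open>Resampling a site beyond \<open>x\<close> leaves \<open>x\<close> empty, so
        the mean vanishes for both values of the new spin.\<close>
      then show ?thesis using x(3) by (simp add: mean_avg_commute[OF fin] avg_def S0)
    qed
    moreover have "depends_only_on (\<lambda>\<xi>. of_bool (\<not> \<xi> (y + 1))) (- S)"
      using yx by (intro depends_vacancy) (simp add: S_def)
    ultimately show ?thesis
      using S0[of \<xi>, OF x(3)] by (auto simp: mean_factor[OF fin] mean_diff[OF fin])
  qed
  have "mean S (euler h a R g) \<xi> = mean S g \<xi>
      + h * (\<Sum>y\<in>{a..<R}. mean S (\<lambda>\<xi>. of_bool (\<not> \<xi> (y + 1)) * (avg y g \<xi> - g \<xi>)) \<xi>)"
    unfolding euler_def[abs_def] mean_add[OF fin] mean_cmult[OF fin] mean_sum[OF fin] ..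
  also have "\<dots> = 0" using g[of x] x zero by (simp add: S_def)
  finally show ?thesis by (simp add: S_def)
qed

text \<open>Expand the square of \<open>g + h * L\<close>. The cross term is minus
  \<open>2 * h\<close> times the Dirichlet form; by Cauchy-Schwarz over \<open>x - a\<close> sites
  and \<open>h * (x - a) \<le> 1\<close>, the quadratic term gives back at most \<open>h\<close>
  times it. The net loss is what \<open>gap\<close> turns into decay.\<close>

lemma euler_contraction:
  assumes gap: "\<gamma> * (mean {a..<x} (\<lambda>\<xi>. (g \<xi>)\<^sup>2) \<zeta> - (mean {a..<x} g \<zeta>)\<^sup>2)
     \<le> (\<Sum>y\<in>{a..<x}. mean {a..<x} (\<lambda>\<xi>. of_bool (\<not> \<xi> (y + 1)) * vari y g \<xi>) \<zeta>)"
    and zero: "mean {a..<x} g \<zeta> = 0" and h: "0 \<le> h" "h * (x - a) \<le> 1" and ax: "a \<le> x"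
  shows "mean {a..<x} (\<lambda>\<xi>. (euler h a x g \<xi>)\<^sup>2) \<zeta> \<le> (1 - h * \<gamma>) * mean {a..<x} (\<lambda>\<xi>. (g \<xi>)\<^sup>2) \<zeta>"
proof -
  define S where "S = {a..<x}"
  have fin: "finite S" by (simp add: S_def)
  define c :: "int \<Rightarrow> config \<Rightarrow> real" where "c y \<xi> = of_bool (\<not> \<xi> (y + 1))" for y \<xi>
  have c: "depends_only_on (c y) (- {y})" for y
    unfolding c_def by (rule depends_vacancy) simp
  define d where "d y \<xi> = avg y g \<xi> - g \<xi>" for y \<xi>
  define D where "D y = mean S (\<lambda>\<xi>. c y \<xi> * vari y g \<xi>) \<zeta>" for y
  have avg1: "avg y (\<lambda>\<xi>. g \<xi> * d y \<xi>) = (\<lambda>\<xi>. - vari y g \<xi>)" for y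
    by (auto simp: d_def avg_def vari_def power2_eq_square algebra_simps)
  have avg2: "avg y (\<lambda>\<xi>. (d y \<xi>)\<^sup>2) = vari y g" for y
    by (auto simp: d_def avg_def vari_def power2_eq_square algebra_simps)
  have D1: "mean S (\<lambda>\<xi>. c y \<xi> * (g \<xi> * d y \<xi>)) \<zeta> = - D y" if "y \<in> S" for y
    using mean_factor_avg[OF fin that c, of "\<lambda>\<xi>. g \<xi> * d y \<xi>", unfolded avg1]
      mean_cmult[OF fin, of "-1" "\<lambda>\<xi>. c y \<xi> * vari y g \<xi>"] by (simp add: D_def)
  have D2: "mean S (\<lambda>\<xi>. c y \<xi> * (d y \<xi>)\<^sup>2) \<zeta> = D y" if "y \<in> S" for y
    using mean_factor_avg[OF fin that c, of "\<lambda>\<xi>. (d y \<xi>)\<^sup>2", unfolded avg2] by (simp add: D_def)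
  have "mean S (\<lambda>\<xi>. (euler h a x g \<xi>)\<^sup>2) \<zeta>
      \<le> mean S (\<lambda>\<xi>. (g \<xi>)\<^sup>2 + (2 * h * (\<Sum>y\<in>S. c y \<xi> * (g \<xi> * d y \<xi>))
          + h * (\<Sum>y\<in>S. c y \<xi> * (d y \<xi>)\<^sup>2))) \<zeta>"
  proof (rule mean_mono[OF fin])
    fix \<xi>
    define L where "L = (\<Sum>y\<in>S. c y \<xi> * d y \<xi>)"
    have "L\<^sup>2 \<le> (\<Sum>y\<in>S. (c y \<xi> * d y \<xi>)\<^sup>2) * card S"
      unfolding L_def by (rule sum_squared_le_sum_of_squares)
    also have "(\<Sum>y\<in>S. (c y \<xi> * d y \<xi>)\<^sup>2) = (\<Sum>y\<in>S. c y \<xi> * (d y \<xi>)\<^sup>2)"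
      by (intro sum.cong) (auto simp: c_def)
    also have "real (card S) = x - a" using ax by (simp add: S_def)
    finally have "h * (h * L\<^sup>2) \<le> h * (h * ((\<Sum>y\<in>S. c y \<xi> * (d y \<xi>)\<^sup>2) * (x - a)))"
      using h by (intro mult_left_mono) auto
    also have "\<dots> = h * ((h * (x - a)) * (\<Sum>y\<in>S. c y \<xi> * (d y \<xi>)\<^sup>2))" by simp
    also have "\<dots> \<le> h * (1 * (\<Sum>y\<in>S. c y \<xi> * (d y \<xi>)\<^sup>2))"
      using h by (intro mult_left_mono mult_right_mono sum_nonneg) (auto simp: c_def)
    finally have "h * (h * L\<^sup>2) \<le> h * (\<Sum>y\<in>S. c y \<xi> * (d y \<xi>)\<^sup>2)" by simp
    moreover have "euler h a x g \<xi> = g \<xi> + h * L"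
      by (simp add: euler_def L_def S_def c_def d_def)
    moreover have "(\<Sum>y\<in>S. c y \<xi> * (g \<xi> * d y \<xi>)) = g \<xi> * L"
      by (simp add: L_def sum_distrib_left algebra_simps)
    ultimately show "(euler h a x g \<xi>)\<^sup>2 \<le> (g \<xi>)\<^sup>2 + (2 * h * (\<Sum>y\<in>S. c y \<xi> * (g \<xi> * d y \<xi>))
          + h * (\<Sum>y\<in>S. c y \<xi> * (d y \<xi>)\<^sup>2))"
      by (simp add: power2_eq_square algebra_simps)
  qed
  also have "\<dots> = mean S (\<lambda>\<xi>. (g \<xi>)\<^sup>2) \<zeta> + (2 * h * (\<Sum>y\<in>S. - D y) + h * (\<Sum>y\<in>S. D y))"
    unfolding mean_add[OF fin] mean_cmult[OF fin] mean_sum[OF fin] by (simp add: D1 D2)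
  also have "\<dots> = mean S (\<lambda>\<xi>. (g \<xi>)\<^sup>2) \<zeta> - h * (\<Sum>y\<in>S. D y)"
    by (simp add: sum_negf)
  also have "\<dots> \<le> mean S (\<lambda>\<xi>. (g \<xi>)\<^sup>2) \<zeta> - h * (\<gamma> * mean S (\<lambda>\<xi>. (g \<xi>)\<^sup>2) \<zeta>)"
    using gap zero h(1) by (intro diff_left_mono mult_left_mono) (simp_all add: S_def D_def c_def)
  finally show ?thesis by (simp add: S_def algebra_simps)
qed

text \<open>Given the spins from \<open>x\<close> on, rings at or beyond \<open>x\<close> have total
  weight \<open>h * \<kappa>\<close> and lead to averages again bounded by \<open>N\<close>, with
  the zero at \<open>x + 1\<close> or still at \<open>x\<close>. The remaining weight \<alpha> goes
  to a contracting step inside \<open>{a..<x}\<close>. As \<open>N\<close> bounds all positions at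
  once, the motion of the zero costs nothing:
  \<open>\<alpha> - h * \<gamma> + h * \<kappa> = 1 - h * \<gamma>\<close>.\<close>

lemma euler_square_decay:
  assumes ab: "a \<le> b" and h: "0 \<le> h" "2 * h * (R - a) \<le> 1" and \<gamma>: "0 \<le> \<gamma>" "2 * h * \<gamma> \<le> 1"
    and gap: "\<And>x \<xi>. b < x \<Longrightarrow> \<not> \<xi> x \<Longrightarrow>
      \<gamma> * (mean {a..<x} (\<lambda>\<xi>. (g \<xi>)\<^sup>2) \<xi> - (mean {a..<x} g \<xi>)\<^sup>2)
       \<le> (\<Sum>y\<in>{a..<x}. mean {a..<x} (\<lambda>\<xi>. of_bool (\<not> \<xi> (y + 1)) * vari y g \<xi>) \<xi>)"
    and zero: "\<And>x \<xi>. b < x \<Longrightarrow> x \<le> R \<Longrightarrow> \<not> \<xi> x \<Longrightarrow> mean {a..<x} g \<xi> = 0"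
    and sq: "\<And>x \<xi>. b < x \<Longrightarrow> x \<le> R \<Longrightarrow> \<not> \<xi> x \<Longrightarrow> mean {a..<x} (\<lambda>\<xi>. (g \<xi>)\<^sup>2) \<xi> \<le> N"
    and x: "b < x" "x \<le> R" "\<not> \<zeta> x"
  shows "mean {a..<x} (\<lambda>\<xi>. (euler h a R g \<xi>)\<^sup>2) \<zeta> \<le> (1 - h * \<gamma>) * N"
proof -
  define S where "S = {a..<x}"
  have fin: "finite S" by (simp add: S_def)
  define c :: "int \<Rightarrow> config \<Rightarrow> real" where "c y \<xi> = of_bool (\<not> \<xi> (y + 1))" for y \<xi>
  define \<kappa> where "\<kappa> = (\<Sum>y\<in>{x..<R}. c y \<zeta>)"
  define \<alpha> where "\<alpha> = 1 - h * \<kappa>"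
  \<comment> \<open>The inner step is taken with weight \<alpha> and has to be longer by
    \<open>1 / \<alpha>\<close>. The factor 2 in the bound on \<open>h * (R - a)\<close> gives
    \<open>\<alpha> \<ge> 1 / 2\<close> and keeps \<open>h' * (x - a) \<le> 1\<close>.\<close>
  define h' where "h' = h / \<alpha>"
  have "h * \<kappa> \<le> h * (R - a)"
    unfolding \<kappa>_def c_def using x ab h by (intro vacancy_sum_le) auto
  then have \<alpha>: "1 / 2 \<le> \<alpha>" using h by (simp add: \<alpha>_def)
  have "h * (x - a) \<le> h * (R - a)" using h x by (intro mult_left_mono) auto
  then have h'1: "h * (x - a) \<le> \<alpha>" using \<alpha> h by simp
  have h': "0 \<le> h'" "h' * (x - a) \<le> 1" "\<alpha> * h' = h"
    using \<alpha> h'1 h by (auto simp: h'_def field_simps)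
  have "mean S (\<lambda>\<xi>. (euler h a R g \<xi>)\<^sup>2) \<zeta>
      \<le> mean S (\<lambda>\<xi>. \<alpha> * (euler h' a x g \<xi>)\<^sup>2 + (\<Sum>y\<in>{x..<R}. h * c y \<zeta> * avg y (\<lambda>\<xi>. (g \<xi>)\<^sup>2) \<xi>)) \<zeta>"
  proof (rule mean_mono[OF fin])
    fix \<xi> assume \<xi>: "\<And>y. y \<notin> S \<Longrightarrow> \<xi> y = \<zeta> y"
    have c: "c y \<zeta> = c y \<xi>" if "y \<in> {x..<R}" for y
      using that \<xi>[of "y + 1"] by (simp add: c_def S_def)
    have "{a..<R} = S \<union> {x..<R}" "S \<inter> {x..<R} = {}" using ab x by (auto simp: S_def)
    then have "euler h a R g \<xi> = g \<xi> + h * (\<Sum>y\<in>S. c y \<xi> * (avg y g \<xi> - g \<xi>))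
        + h * (\<Sum>y\<in>{x..<R}. c y \<xi> * (avg y g \<xi> - g \<xi>))"
      by (simp add: euler_def c_def sum.union_disjoint fin algebra_simps)
    also have "(\<Sum>y\<in>{x..<R}. c y \<xi> * (avg y g \<xi> - g \<xi>)) = (\<Sum>y\<in>{x..<R}. c y \<zeta> * avg y g \<xi>) - \<kappa> * g \<xi>"
      by (simp add: \<kappa>_def c right_diff_distrib sum_subtractf sum_distrib_right)
    also have "g \<xi> + h * (\<Sum>y\<in>S. c y \<xi> * (avg y g \<xi> - g \<xi>)) + h * ((\<Sum>y\<in>{x..<R}. c y \<zeta> * avg y g \<xi>) - \<kappa> * g \<xi>)
        = \<alpha> * euler h' a x g \<xi> + (\<Sum>y\<in>{x..<R}. h * c y \<zeta> * avg y g \<xi>)"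
    proof -
      have "\<alpha> * euler h' a x g \<xi> = \<alpha> * g \<xi> + h * (\<Sum>y\<in>S. c y \<xi> * (avg y g \<xi> - g \<xi>))"
        unfolding euler_def c_def S_def distrib_left mult.assoc[symmetric] h'(3) ..
      then show ?thesis
        by (simp add: \<alpha>_def right_diff_distrib left_diff_distrib sum_distrib_left mult.assoc)
    qed
    finally have "(euler h a R g \<xi>)\<^sup>2
        = (\<alpha> * euler h' a x g \<xi> + (\<Sum>y\<in>{x..<R}. h * c y \<zeta> * avg y g \<xi>))\<^sup>2" by simp
    also have "\<dots> \<le> \<alpha> * (euler h' a x g \<xi>)\<^sup>2 + (\<Sum>y\<in>{x..<R}. h * c y \<zeta> * (avg y g \<xi>)\<^sup>2)"
      using \<alpha> h by (intro jensen_square) (auto simp: c_def \<alpha>_def \<kappa>_def sum_distrib_left)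
    also have "\<dots> \<le> \<alpha> * (euler h' a x g \<xi>)\<^sup>2 + (\<Sum>y\<in>{x..<R}. h * c y \<zeta> * avg y (\<lambda>\<xi>. (g \<xi>)\<^sup>2) \<xi>)"
      using h mean_square_le[of "{y}" g \<xi> for y]
      by (intro add_left_mono sum_mono mult_left_mono) (auto simp: c_def mean_singleton)
    finally show "(euler h a R g \<xi>)\<^sup>2
      \<le> \<alpha> * (euler h' a x g \<xi>)\<^sup>2 + (\<Sum>y\<in>{x..<R}. h * c y \<zeta> * avg y (\<lambda>\<xi>. (g \<xi>)\<^sup>2) \<xi>)" .
  qed
  also have "\<dots> = \<alpha> * mean S (\<lambda>\<xi>. (euler h' a x g \<xi>)\<^sup>2) \<zeta>
      + (\<Sum>y\<in>{x..<R}. h * c y \<zeta> * mean S (avg y (\<lambda>\<xi>. (g \<xi>)\<^sup>2)) \<zeta>)"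
    unfolding mean_add[OF fin] mean_cmult[OF fin] mean_sum[OF fin] ..
  also have "\<dots> \<le> \<alpha> * ((1 - h' * \<gamma>) * mean S (\<lambda>\<xi>. (g \<xi>)\<^sup>2) \<zeta>) + (\<Sum>y\<in>{x..<R}. h * c y \<zeta> * N)"
  proof (rule add_mono[OF mult_left_mono sum_mono])
    show "mean S (\<lambda>\<xi>. (euler h' a x g \<xi>)\<^sup>2) \<zeta> \<le> (1 - h' * \<gamma>) * mean S (\<lambda>\<xi>. (g \<xi>)\<^sup>2) \<zeta>"
      unfolding S_def using x ab gap[of x \<zeta>, OF x(1,3)] zero[of x \<zeta>, OF x] h' by (intro euler_contraction) auto
    show "0 \<le> \<alpha>" using \<alpha> by simp
    fix y assume y: "y \<in> {x..<R}"
    have "mean S (avg y (\<lambda>\<xi>. (g \<xi>)\<^sup>2)) \<zeta> \<le> N" if cy: "\<not> \<zeta> (y + 1)"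
    proof (cases "y = x")
      case True
      have "insert x S = {a..<x + 1}" using ab x by (auto simp: S_def)
      then show ?thesis using sq[of "x + 1" \<zeta>] cy y x True by (simp add: mean_avg[OF fin])
    next
      case False
      have "mean S (\<lambda>\<xi>. (g \<xi>)\<^sup>2) (\<zeta>(y := e)) \<le> N" for e
        unfolding S_def using x False by (intro sq) auto
      then have "mean {y} (mean S (\<lambda>\<xi>. (g \<xi>)\<^sup>2)) \<zeta> \<le> mean {y} (\<lambda>_. N) \<zeta>"
        using p_nonneg p_less_1 by (auto simp: mean_singleton avg_def intro!: add_mono mult_left_mono)
      also have "\<dots> = N" by simp
      finally show ?thesis by (simp add: mean_avg_commute[OF fin] mean_singleton)
    qed
    then show "h * c y \<zeta> * mean S (avg y (\<lambda>\<xi>. (g \<xi>)\<^sup>2)) \<zeta> \<le> h * c y \<zeta> * N"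
      using h(1) by (auto simp: c_def intro: mult_left_mono)
  qed
  also have "\<dots> = (\<alpha> - h * \<gamma>) * mean S (\<lambda>\<xi>. (g \<xi>)\<^sup>2) \<zeta> + h * \<kappa> * N"
    using h'(3) by (simp add: \<kappa>_def sum_distrib_left sum_distrib_right algebra_simps)
  \<comment> \<open>The coefficient is nonnegative because
    \<open>h * \<gamma> \<le> 1 / 2 \<le> \<alpha>\<close>.\<close>
  also have "\<dots> \<le> (\<alpha> - h * \<gamma>) * N + h * \<kappa> * N"
    using \<alpha> \<gamma> sq[of x \<zeta>, OF x] by (intro add_right_mono mult_left_mono) (auto simp: S_def)
  also have "\<dots> = (1 - h * \<gamma>) * N" by (simp add: \<alpha>_def algebra_simps)
  finally show ?thesis by (simp add: S_def)
qed

text \<open>Every configuration of the spins in \<open>S\<close> has mass at least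
  \<open>min p (1 - p) ^ card S\<close>.\<close>

lemma pointwise_le_mean:
  assumes "finite S" "\<And>\<xi>. 0 \<le> g \<xi>"
  shows "min p (1 - p) ^ card S * g \<zeta> \<le> mean S g \<zeta>"
  using assms(1)
proof (induction S rule: finite_induct)
  case (insert x S)
  define r where "r = min p (1 - p)"
  have r: "0 \<le> r" "r \<le> p" "r \<le> 1 - p" using p_nonneg p_less_1 by (auto simp: r_def)
  have 0: "0 \<le> mean S g \<xi>" for \<xi> using insert.hyps(1) assms(2) by (rule mean_nonneg)
  have le_avg: "r * mean S g (\<zeta>(x := e)) \<le> avg x (mean S g) \<zeta>" for e
  proof -
    define u v where "u = mean S g (\<zeta>(x := True))" and "v = mean S g (\<zeta>(x := False))"
    have "r * u \<le> p * u" "r * v \<le> (1 - p) * v" "0 \<le> p * u" "0 \<le> (1 - p) * v"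
      using r 0 p_nonneg p_less_1 by (auto simp: u_def v_def intro: mult_right_mono)
    then have "r * u \<le> p * u + (1 - p) * v" "r * v \<le> p * u + (1 - p) * v" by linarith+
    then show ?thesis by (cases e) (simp_all only: avg_def u_def v_def)
  qed
  have "r ^ card (insert x S) * g \<zeta> \<le> r * mean S g \<zeta>"
    using insert r by (simp add: r_def mult_left_mono mult.assoc)
  also have "\<dots> \<le> avg x (mean S g) \<zeta>"
    using le_avg[of "\<zeta> x"] by (simp only: fun_upd_triv)
  finally show ?case using insert.hyps by (simp add: mean_insert r_def)
qed simp

text \<open>For \<open>p = 0\<close> the measure is a point mass and the bound in square mean carries no pointwise
  information, but zeros then never disappear and a weighted count of the ones left of \<open>z\<close>
  contracts.\<close>

lemma euler_decay_degenerate: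
  fixes h :: real
  assumes p: "p = 0" and ab: "a \<le> b" "b < z" "z \<le> R" and h: "0 \<le> h" "h * real_of_int (R - a) \<le> 1"
    and f: "depends_only_on f {a..b}" "\<And>\<xi>. \<bar>f \<xi>\<bar> \<le> B" "\<And>\<xi>. mean {a..b} f \<xi> = 0"
    and \<xi>: "\<not> \<xi> z"
  shows "\<bar>(euler h a R ^^ n) f \<xi>\<bar>
    \<le> (1 - h / 2) ^ n * B * (\<Sum>y\<in>{a..<z}. 2 ^ nat (y - a) * of_bool (\<xi> y))"
  using \<xi>
proof (induction n arbitrary: \<xi>)
  case 0
  have avg0: "avg x g \<zeta> = g (\<zeta>(x := False))" for x g \<zeta>
    unfolding avg_def using p by simp
  define W :: real where "W = (\<Sum>y\<in>{a..<z}. 2 ^ nat (y - a) * of_bool (\<xi> y))"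
  have B: "0 \<le> B" using f(2) abs_ge_zero order.trans by blast
  have "\<bar>f \<xi>\<bar> \<le> B * W"
  proof (cases "\<exists>y\<in>{a..<z}. \<xi> y")
    case True
    then obtain y where y: "y \<in> {a..<z}" "\<xi> y" by blast
    then have "2 ^ nat (y - a) * of_bool (\<xi> y) \<le> W"
      unfolding W_def by (intro member_le_sum) auto
    moreover have "1 \<le> (2 :: real) ^ nat (y - a)" by (rule one_le_power) simp
    ultimately have "1 \<le> W" using y(2) by (simp only: of_bool_eq mult_1_right)
    then have "B * 1 \<le> B * W" using B by (rule mult_left_mono)
    then show ?thesis using f(2)[of \<xi>] by simp
  next
    case False
    \<comment> \<open>For \<open>p = 0\<close> averaging means emptying, so centredness says that
      \<open>f\<close> vanishes wherever \<open>{a..b}\<close> is empty.\<close>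
    have "f \<zeta> = 0" if "\<forall>y\<in>{a..b}. \<not> \<zeta> y" for \<zeta>
    proof -
      have "mean S f \<zeta> = f \<zeta>" if "finite S" "S \<subseteq> {a..b}" "\<forall>y\<in>{a..b}. \<not> \<zeta> y" for S \<zeta>
        using that
      proof (induction S arbitrary: \<zeta> rule: finite_induct)
        case (insert x S)
        then have "\<zeta>(x := False) = \<zeta>" by (auto simp: fun_eq_iff)
        with insert show ?case by (simp add: mean_insert avg0)
      qed simp
      then show ?thesis using that f(3)[of \<zeta>] by (metis finite_atLeastAtMost_int order_refl)
    qed
    then have "f \<xi> = 0" using False ab by auto
    moreover have "0 \<le> W" unfolding W_def by (intro sum_nonneg) auto
    ultimately show ?thesis using B by simp
  qed
  then show ?case by (simp add: W_def)
next
  case (Suc n)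
  have avg0: "avg x g \<zeta> = g (\<zeta>(x := False))" for x g \<zeta>
    unfolding avg_def using p by simp
  define F where "F = (euler h a R ^^ n) f"
  define C where "C = (1 - h / 2) ^ n * B"
  define W :: "config \<Rightarrow> real" where "W \<zeta> = (\<Sum>y\<in>{a..<z}. 2 ^ nat (y - a) * of_bool (\<zeta> y))" for \<zeta>
  have IH: "\<bar>F \<zeta>\<bar> \<le> C * W \<zeta>" if "\<not> \<zeta> z" for \<zeta>
    using Suc.IH[of \<zeta>, OF that] by (simp add: F_def C_def W_def)
  have B: "0 \<le> B" using f(2) abs_ge_zero order.trans by blast
  have "h * 1 \<le> h * real_of_int (R - a)" using h(1) ab by (intro mult_left_mono) auto
  then have h1: "h \<le> 1" using h(2) by simp
  have C: "0 \<le> C" using B h1 by (simp add: C_def)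
  define c :: "int \<Rightarrow> real" where "c x = of_bool (\<not> \<xi> (x + 1))" for x
  define K where "K = (\<Sum>x\<in>{a..<R}. c x)"
  have K: "h * K \<le> 1"
    using vacancy_sum_le[OF h(1), of "{a..<R}" a R "\<lambda>x. \<not> \<xi> (x + 1)"] h(2) ab
    unfolding K_def c_def by (auto simp del: sum_of_bool_eq)
  have W_upd: "W (\<xi>(x := False)) = W \<xi> - (if x \<in> {a..<z} then 2 ^ nat (x - a) * of_bool (\<xi> x) else 0)" for x
  proof (cases "x \<in> {a..<z}")
    case True
    have "W \<zeta> = 2 ^ nat (x - a) * of_bool (\<zeta> x) + (\<Sum>y\<in>{a..<z} - {x}. 2 ^ nat (y - a) * of_bool (\<zeta> y))" for \<zeta>
      unfolding W_def using True by (intro sum.remove) auto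
    from this[of \<xi>] this[of "\<xi>(x := False)"] show ?thesis using True by simp
  next
    case False
    then have "W (\<xi>(x := False)) = W \<xi>" unfolding W_def by (intro sum.cong) auto
    then show ?thesis by (simp only: False if_False diff_zero)
  qed
  have drift: "(\<Sum>x\<in>{a..<z}. c x * (2 ^ nat (x - a) * of_bool (\<xi> x))) \<ge> W \<xi> / 2"
  proof -
    define t :: "int \<Rightarrow> real" where "t y = 2 ^ nat (y - a) * of_bool (\<xi> y)" for y
    have t0: "0 \<le> t y" for y by (simp add: t_def)
    \<comment> \<open>The weights double to the right, so a one at \<open>x\<close> blocked by a one
      at \<open>x + 1\<close> is paid for by half the weight of its blocker. Summation leaves half
      of \<open>W\<close>, the origin of the rate 1/2.\<close>
    have "t x - t (x + 1) / 2 \<le> c x * t x" if "x \<in> {a..<z}" for x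
    proof -
      have "nat (x + 1 - a) = Suc (nat (x - a))" using that by auto
      then show ?thesis by (simp add: t_def c_def)
    qed
    then have "(\<Sum>x\<in>{a..<z}. t x - t (x + 1) / 2) \<le> (\<Sum>x\<in>{a..<z}. c x * t x)"
      by (rule sum_mono)
    moreover have "(\<Sum>x\<in>{a..<z}. t (x + 1)) \<le> (\<Sum>x\<in>{a..<z}. t x)"
    proof -
      have "(\<Sum>x\<in>{a..<z}. t (x + 1) - t x) = t z - t a"
        using ab by (intro sum_telescope_int) auto
      \<comment> \<open>The empty site \<open>z\<close> closes the telescoping sum.\<close>
      moreover have "t z = 0" using Suc.prems by (simp add: t_def)
      ultimately show ?thesis using t0[of a] by (simp add: sum_subtractf)
    qed
    ultimately show ?thesis
      unfolding W_def t_def[symmetric] by (simp add: sum_subtractf sum_divide_distrib[symmetric])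
  qed
  have "\<bar>\<Sum>x\<in>{a..<R}. c x * avg x F \<xi>\<bar> \<le> (\<Sum>x\<in>{a..<R}. c x * (C * W (\<xi>(x := False))))"
  proof (rule order.trans[OF sum_abs sum_mono])
    fix x
    \<comment> \<open>Rings only create zeros, so \<open>z\<close> stays empty and the induction
      hypothesis applies.\<close>
    have "\<bar>avg x F \<xi>\<bar> \<le> C * W (\<xi>(x := False))"
      using IH[of "\<xi>(x := False)"] Suc.prems by (simp add: avg0)
    then show "\<bar>c x * avg x F \<xi>\<bar> \<le> c x * (C * W (\<xi>(x := False)))"
      by (simp add: abs_mult c_def)
  qed
  also have "\<dots> = C * (K * W \<xi> - (\<Sum>x\<in>{a..<z}. c x * (2 ^ nat (x - a) * of_bool (\<xi> x))))"
  proof -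
    have "{a..<R} \<inter> {a..<z} = {a..<z}" using ab by auto
    then have "(\<Sum>x\<in>{a..<R}. c x * (if x \<in> {a..<z} then 2 ^ nat (x - a) * of_bool (\<xi> x) else 0))
        = (\<Sum>x\<in>{a..<z}. c x * (2 ^ nat (x - a) * of_bool (\<xi> x)))"
      using sum.inter_restrict[of "{a..<R}" "\<lambda>x. c x * (2 ^ nat (x - a) * of_bool (\<xi> x))" "{a..<z}"]
      by (simp add: if_distrib cong: if_cong)
    then show ?thesis
      unfolding W_upd
      by (simp only: K_def right_diff_distrib sum_subtractf mult.left_commute[of _ C] sum_distrib_left[symmetric]
          sum_distrib_right[symmetric])
  qed
  also have "\<dots> \<le> C * (K * W \<xi> - W \<xi> / 2)"
    using drift C by (intro mult_left_mono diff_left_mono) auto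
  finally have 1: "\<bar>h * (\<Sum>x\<in>{a..<R}. c x * avg x F \<xi>)\<bar> \<le> h * (C * (K * W \<xi> - W \<xi> / 2))"
    using h(1) by (simp add: abs_mult mult_left_mono)
  have 2: "\<bar>(1 - h * K) * F \<xi>\<bar> \<le> (1 - h * K) * (C * W \<xi>)"
    using K IH[of \<xi>, OF Suc.prems] by (simp add: abs_mult mult_left_mono)
  have "\<bar>euler h a R F \<xi>\<bar> \<le> (1 - h * K) * (C * W \<xi>) + h * (C * (K * W \<xi> - W \<xi> / 2))"
    unfolding euler_convex c_def[symmetric] K_def[symmetric]
    by (rule order.trans[OF abs_triangle_ineq add_mono[OF 2 1]])
  also have "\<dots> = (1 - h / 2) * C * W \<xi>" by (simp add: algebra_simps)
  finally show ?case by (simp add: F_def C_def W_def mult.assoc)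
qed

text \<open>The order of quantifiers matters: \<open>m\<close> depends on \<open>p\<close> only,
  \<open>C\<close> neither on the freezing site \<open>R\<close> nor on the mesh, while
  \<open>h0\<close> may shrink with \<open>R\<close>. So the bound survives both limits taken
  later.\<close>

lemma euler_decay:
  "\<exists>m>0. \<forall>a b z \<eta> f B. a \<le> b \<longrightarrow> b < z \<longrightarrow> \<not> \<eta> z \<longrightarrow> depends_only_on f {a..b} \<longrightarrow>
     (\<forall>\<xi>. \<bar>f \<xi>\<bar> \<le> B) \<longrightarrow> (\<forall>\<xi>. mean {a..b} f \<xi> = 0) \<longrightarrow>
     (\<exists>C. \<forall>R\<ge>z. \<exists>h0>0. \<forall>(h::real) n. 0 < h \<longrightarrow> h < h0 \<longrightarrow>
        \<bar>(euler h a R ^^ n) f \<eta>\<bar> \<le> C * exp (- (m * (h * real n))))"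
proof (cases "p = 0")
  case True
  show ?thesis
  proof (rule exI[of _ "1/2"], intro conjI allI impI)
    fix a b z :: int and \<eta> f B
    assume ab: "a \<le> b" "b < z" and z: "\<not> \<eta> z" and f: "depends_only_on f {a..b}"
      and B: "\<forall>\<xi>. \<bar>f \<xi>\<bar> \<le> B" and zero: "\<forall>\<xi>. mean {a..b} f \<xi> = 0"
    define W :: real where "W = (\<Sum>y\<in>{a..<z}. 2 ^ nat (y - a) * of_bool (\<eta> y))"
    have B0: "0 \<le> B" using B abs_ge_zero order.trans by blast
    have W0: "0 \<le> W" unfolding W_def by (intro sum_nonneg) auto
    show "\<exists>C. \<forall>R\<ge>z. \<exists>h0>0. \<forall>(h::real) n. 0 < h \<longrightarrow> h < h0 \<longrightarrow>
        \<bar>(euler h a R ^^ n) f \<eta>\<bar> \<le> C * exp (- (1 / 2 * (h * real n)))"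
    proof (rule exI[of _ "B * W"], intro allI impI)
      fix R assume R: "z \<le> R"
      show "\<exists>h0>0. \<forall>(h::real) n. 0 < h \<longrightarrow> h < h0 \<longrightarrow>
        \<bar>(euler h a R ^^ n) f \<eta>\<bar> \<le> B * W * exp (- (1 / 2 * (h * real n)))"
      proof (rule exI[of _ "1 / real_of_int (R - a)"], intro conjI allI impI)
        show "0 < 1 / real_of_int (R - a)" using ab R by simp
        fix h :: real and n assume h: "0 < h" "h < 1 / real_of_int (R - a)"
        have Ra: "1 \<le> real_of_int (R - a)" using ab R by simp
        then have hR: "h * real_of_int (R - a) \<le> 1" using h by (simp add: field_simps)
        have "h * 1 \<le> h * real_of_int (R - a)" using Ra h by (intro mult_left_mono) auto
        then have h1: "h \<le> 1" using hR by simp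
        have "\<bar>(euler h a R ^^ n) f \<eta>\<bar> \<le> (1 - h / 2) ^ n * B * W"
          unfolding W_def using True ab R h hR f B zero z
          by (intro euler_decay_degenerate) auto
        also have "\<dots> = B * W * (1 - h / 2) ^ n" by simp
        also have "\<dots> \<le> B * W * exp (- (h / 2 * real n))"
          using B0 W0 h h1 by (intro mult_left_mono one_minus_power_le_exp) auto
        finally show "\<bar>(euler h a R ^^ n) f \<eta>\<bar> \<le> B * W * exp (- (1 / 2 * (h * real n)))" by simp
      qed
    qed
  qed simp
next
  case False
  obtain \<gamma> where \<gamma>: "0 < \<gamma>" and gap: "\<And>a v \<zeta> g. a \<le> v \<Longrightarrow> \<not> \<zeta> v \<Longrightarrow>
     \<gamma> * (mean {a..<v} (\<lambda>\<xi>. (g \<xi>)\<^sup>2) \<zeta> - (mean {a..<v} g \<zeta>)\<^sup>2)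
     \<le> (\<Sum>y\<in>{a..<v}. mean {a..<v} (\<lambda>\<xi>. of_bool (\<not> \<xi> (y + 1)) * vari y g \<xi>) \<zeta>)"
    using east_poincare by blast
  define r where "r = min p (1 - p)"
  have r: "0 < r" using False p_nonneg p_less_1 by (simp add: r_def)
  show ?thesis
  proof (rule exI[of _ "\<gamma> / 2"], intro conjI allI impI)
    fix a b z :: int and \<eta> f B
    assume ab: "a \<le> b" "b < z" and z: "\<not> \<eta> z" and f: "depends_only_on f {a..b}"
      and B: "\<forall>\<xi>. \<bar>f \<xi>\<bar> \<le> B" and zero: "\<forall>\<xi>. mean {a..b} f \<xi> = 0"
    define w where "w = r ^ card {a..<z}"
    have w: "0 < w" using r by (simp add: w_def)
    \<comment> \<open>\<open>w\<close> bounds from below the mass of a configuration on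
      \<open>{a..<z}\<close>; the root undoes the square in the mean bound.\<close>
    define C where "C = sqrt (B\<^sup>2 / w)"
    have C: "0 \<le> C" "C\<^sup>2 = B\<^sup>2 / w" using w by (auto simp: C_def)
    show "\<exists>C. \<forall>R\<ge>z. \<exists>h0>0. \<forall>(h::real) n. 0 < h \<longrightarrow> h < h0 \<longrightarrow>
        \<bar>(euler h a R ^^ n) f \<eta>\<bar> \<le> C * exp (- (\<gamma> / 2 * (h * real n)))"
    proof (rule exI[of _ C], intro allI impI)
      fix R assume R: "z \<le> R"
      define h0 where "h0 = min (1 / (2 * real_of_int (R - a))) (1 / (2 * \<gamma>))"
      show "\<exists>h0>0. \<forall>(h::real) n. 0 < h \<longrightarrow> h < h0 \<longrightarrow>
        \<bar>(euler h a R ^^ n) f \<eta>\<bar> \<le> C * exp (- (\<gamma> / 2 * (h * real n)))"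
      proof (rule exI[of _ h0], intro conjI allI impI)
        show "0 < h0" using ab R \<gamma> by (simp add: h0_def)
        fix h :: real and n assume h: "0 < h" "h < h0"
        have "0 < real_of_int (R - a)" using ab R by simp
        then have hR: "2 * h * real_of_int (R - a) \<le> 1" and h\<gamma>: "2 * h * \<gamma> \<le> 1"
          using h \<gamma> by (auto simp: h0_def field_simps)
        define F where "F n = (euler h a R ^^ n) f" for n
        \<comment> \<open>Both claims are carried for every position \<open>x\<close> the zero may
          have reached; only at the end is \<open>x = z\<close>.\<close>
        have "mean {a..<x} (F n) \<xi> = 0 \<and> mean {a..<x} (\<lambda>\<xi>. (F n \<xi>)\<^sup>2) \<xi> \<le> (1 - h * \<gamma>) ^ n * B\<^sup>2"
          if "b < x" "x \<le> R" "\<not> \<xi> x" for n x \<xi>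
          using that
        proof (induction n arbitrary: x \<xi>)
          case 0
          have "mean {a..<x} f = mean {a..<x} (mean {a..b} f)"
            using ab 0 by (intro mean_subset[symmetric]) auto
          also have "mean {a..b} f = (\<lambda>_. 0)" using zero by auto
          finally have "mean {a..<x} f \<xi> = 0" by simp
          moreover have "mean {a..<x} (\<lambda>\<xi>. (f \<xi>)\<^sup>2) \<xi> \<le> mean {a..<x} (\<lambda>_. B\<^sup>2) \<xi>"
            using B by (intro mean_mono) (auto simp: abs_le_square_iff[symmetric] intro: order.trans[OF _ abs_ge_self])
          ultimately show ?case by (simp add: F_def)
        next
          case (Suc n)
          have "mean {a..<x} (euler h a R (F n)) \<xi> = 0"
            using Suc.IH Suc.prems ab(1) by (intro euler_mean_zero) auto
          moreover have "mean {a..<x} (\<lambda>\<xi>. (euler h a R (F n) \<xi>)\<^sup>2) \<xi> \<le> (1 - h * \<gamma>) * ((1 - h * \<gamma>) ^ n * B\<^sup>2)"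
            using Suc.IH Suc.prems ab(1) h hR h\<gamma> \<gamma>
            by (intro euler_square_decay[where b = b] gap) auto
          ultimately show ?case by (simp add: F_def)
        qed
        from this[of z \<eta> n, OF ab(2) R z]
        have "mean {a..<z} (\<lambda>\<xi>. (F n \<xi>)\<^sup>2) \<eta> \<le> (1 - h * \<gamma>) ^ n * B\<^sup>2" by simp
        moreover have "w * (F n \<eta>)\<^sup>2 \<le> mean {a..<z} (\<lambda>\<xi>. (F n \<xi>)\<^sup>2) \<eta>"
          unfolding w_def r_def by (rule pointwise_le_mean) auto
        moreover have "(1 - h * \<gamma>) ^ n * B\<^sup>2 \<le> exp (- (h * \<gamma> * real n)) * B\<^sup>2"
          using h h\<gamma> \<gamma> by (intro mult_right_mono one_minus_power_le_exp) auto
        ultimately have "w * (F n \<eta>)\<^sup>2 \<le> exp (- (h * \<gamma> * real n)) * B\<^sup>2" by linarith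
        then have "(F n \<eta>)\<^sup>2 \<le> B\<^sup>2 / w * exp (- (h * \<gamma> * real n))"
          using w by (simp add: field_simps)
        also have "\<dots> = (C * exp (- (\<gamma> / 2 * (h * real n))))\<^sup>2"
          using C(2) by (simp add: power_mult_distrib exp_double[symmetric] algebra_simps)
        finally have "\<bar>F n \<eta>\<bar> \<le> \<bar>C * exp (- (\<gamma> / 2 * (h * real n)))\<bar>"
          by (simp only: abs_le_square_iff)
        then show "\<bar>(euler h a R ^^ n) f \<eta>\<bar> \<le> C * exp (- (\<gamma> / 2 * (h * real n)))"
          using C(1) by (simp add: F_def abs_mult)
      qed
    qed
  qed (use \<gamma> in simp)
qed

section \<open>Finite speed of propagation\<close>

lemma abs_avg_diff_le: "\<bar>avg x g \<xi> - g \<xi>\<bar> \<le> \<bar>g (\<xi>(x := True)) - g (\<xi>(x := False))\<bar>"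
proof -
  define D where "D = g (\<xi>(x := True)) - g (\<xi>(x := False))"
  have "avg x g \<xi> - g (\<xi>(x := \<xi> x)) = (if \<xi> x then - (1 - p) * D else p * D)"
    by (cases "\<xi> x") (simp_all add: avg_def D_def algebra_simps)
  moreover have "\<bar>p * D\<bar> \<le> 1 * \<bar>D\<bar>" "\<bar>- (1 - p) * D\<bar> \<le> 1 * \<bar>D\<bar>"
    using p_nonneg p_less_1 unfolding abs_mult by (intro mult_right_mono; simp)+
  ultimately show ?thesis by (simp add: D_def split: if_splits)
qed

text \<open>The spin at \<open>y\<close> acts in two ways. Through the values of \<open>g\<close>
  its influence undergoes a weighted average, which keeps \<delta>; as the constraint of
  \<open>y - 1\<close> it switches one ring on or off, which adds at most
  \<open>h * \<delta>'\<close>.\<close>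

lemma euler_influence_step:
  fixes h :: real
  assumes h: "0 \<le> h" "h * real_of_int (R - a) \<le> 1" and aR: "a \<le> R"
    and y: "\<And>\<xi>. \<bar>g (\<xi>(y := True)) - g (\<xi>(y := False))\<bar> \<le> \<delta>"
    and y1: "\<And>\<xi>. \<bar>g (\<xi>(y - 1 := True)) - g (\<xi>(y - 1 := False))\<bar> \<le> \<delta>'"
  shows "\<bar>euler h a R g (\<xi>(y := True)) - euler h a R g (\<xi>(y := False))\<bar> \<le> \<delta> + h * \<delta>'"
proof -
  define d where "d \<zeta> = g (\<zeta>(y := True)) - g (\<zeta>(y := False))" for \<zeta>
  define c :: "int \<Rightarrow> real" where "c x = of_bool (\<not> \<xi> (x + 1))" for x
  define I where "I = {a..<R} - {y - 1}"
  define J where "J = {a..<R} \<inter> {y - 1}"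
  have I: "{a..<R} = I \<union> J" "I \<inter> J = {}" "finite I" "finite J" "I \<subseteq> {a..<R}"
    by (auto simp: I_def J_def)
  define e where "e x b = of_bool (\<not> (\<xi>(y := b)) (x + 1)) * (avg x g (\<xi>(y := b)) - g (\<xi>(y := b)))" for x b
  \<comment> \<open>Resampling \<open>y\<close> itself erases its influence.\<close>
  define k where "k x = (if x = y then 0 else avg x d \<xi>)" for x
  have \<delta>: "0 \<le> \<delta>" "0 \<le> \<delta>'" using y y1 abs_ge_zero order.trans by blast+
  have eI: "e x True - e x False = c x * k x - c x * d \<xi>" if "x \<in> I" for x
  proof -
    have "x + 1 \<noteq> y" using that by (auto simp: I_def)
    then have "e x True - e x False
        = c x * ((avg x g (\<xi>(y := True)) - avg x g (\<xi>(y := False))) - d \<xi>)"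
      by (simp add: e_def c_def d_def algebra_simps)
    also have "avg x g (\<xi>(y := True)) - avg x g (\<xi>(y := False)) = k x"
      using fun_upd_twist[of x y \<xi>] by (cases "x = y") (simp_all add: k_def avg_def d_def algebra_simps)
    finally show ?thesis by (simp add: algebra_simps)
  qed
  have k_le: "\<bar>k x\<bar> \<le> \<delta>" for x
    using \<delta> y by (auto simp: k_def d_def intro!: abs_avg_le)
  define K where "K = (\<Sum>x\<in>I. c x)"
  have K: "h * K \<le> 1" "0 \<le> K"
    using vacancy_sum_le[OF h(1) I(5) aR, of "\<lambda>x. \<not> \<xi> (x + 1)"] h(2)
    by (auto simp: K_def c_def intro!: sum_nonneg simp del: sum_of_bool_eq)
  have split: "euler h a R g (\<xi>(y := True)) - euler h a R g (\<xi>(y := False))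
      = (1 - h * K) * d \<xi> + h * (\<Sum>x\<in>I. c x * k x) + h * (\<Sum>x\<in>J. e x True - e x False)"
  proof -
    have "euler h a R g (\<xi>(y := True)) - euler h a R g (\<xi>(y := False))
        = d \<xi> + h * (\<Sum>x\<in>{a..<R}. e x True - e x False)"
    proof -
      have "euler h a R g (\<xi>(y := b)) = g (\<xi>(y := b)) + h * (\<Sum>x\<in>{a..<R}. e x b)" for b
        by (simp only: euler_def e_def)
      then show ?thesis by (simp add: d_def sum_subtractf right_diff_distrib)
    qed
    also have "(\<Sum>x\<in>{a..<R}. e x True - e x False)
        = (\<Sum>x\<in>I. c x * k x - c x * d \<xi>) + (\<Sum>x\<in>J. e x True - e x False)"
      unfolding I(1) using I eI by (simp add: sum.union_disjoint)
    also have "(\<Sum>x\<in>I. c x * k x - c x * d \<xi>) = (\<Sum>x\<in>I. c x * k x) - K * d \<xi>"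
      by (simp only: K_def sum_subtractf sum_distrib_right)
    also have "d \<xi> + h * ((\<Sum>x\<in>I. c x * k x) - K * d \<xi> + (\<Sum>x\<in>J. e x True - e x False))
        = (1 - h * K) * d \<xi> + h * (\<Sum>x\<in>I. c x * k x) + h * (\<Sum>x\<in>J. e x True - e x False)"
      by (simp only: distrib_left right_diff_distrib left_diff_distrib mult_1 mult.assoc)
    finally show ?thesis .
  qed
  have "\<bar>\<Sum>x\<in>I. c x * k x\<bar> \<le> (\<Sum>x\<in>I. c x * \<delta>)"
    using k_le by (intro order.trans[OF sum_abs] sum_mono) (auto simp: c_def abs_mult)
  then have b1: "\<bar>h * (\<Sum>x\<in>I. c x * k x)\<bar> \<le> h * (K * \<delta>)"
    using h(1) by (simp add: K_def sum_distrib_right abs_mult mult_left_mono)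
  have b2: "\<bar>(1 - h * K) * d \<xi>\<bar> \<le> (1 - h * K) * \<delta>"
    using K y by (simp add: d_def abs_mult mult_left_mono)
  have "\<bar>e (y - 1) True - e (y - 1) False\<bar> \<le> \<delta>'"
  proof -
    define \<zeta> where "\<zeta> = \<xi>(y := False)"
    \<comment> \<open>With \<open>y\<close> occupied the ring at \<open>y - 1\<close> is illegal, so
      only one term remains.\<close>
    have "e (y - 1) True - e (y - 1) False = - (avg (y - 1) g \<zeta> - g \<zeta>)"
      by (simp add: e_def \<zeta>_def)
    moreover have "\<bar>avg (y - 1) g \<zeta> - g \<zeta>\<bar> \<le> \<delta>'"
      by (rule order.trans[OF abs_avg_diff_le y1])
    ultimately show ?thesis by simp
  qed
  then have "\<bar>\<Sum>x\<in>J. e x True - e x False\<bar> \<le> \<delta>'"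
    using \<delta> by (cases "y - 1 \<in> {a..<R}") (auto simp: J_def)
  then have b3: "\<bar>h * (\<Sum>x\<in>J. e x True - e x False)\<bar> \<le> h * \<delta>'"
    using h(1) by (simp add: abs_mult mult_left_mono)
  have "\<bar>euler h a R g (\<xi>(y := True)) - euler h a R g (\<xi>(y := False))\<bar>
      \<le> (1 - h * K) * \<delta> + h * (K * \<delta>) + h * \<delta>'"
    unfolding split using b1 b2 b3 by linarith
  then show ?thesis by (simp add: algebra_simps)
qed

lemma euler_funpow_bounded:
  assumes "0 \<le> h" "h * real_of_int (R - a) \<le> 1" "a \<le> R" "\<And>\<xi>. \<bar>f \<xi>\<bar> \<le> B"
  shows "\<bar>(euler h a R ^^ n) f \<xi>\<bar> \<le> B"
  using assms by (induction n arbitrary: \<xi>) (auto intro!: euler_bounded)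

lemma depends_only_on_euler_funpow:
  "depends_only_on f {a..R} \<Longrightarrow> depends_only_on ((euler h a R ^^ n) f) {a..R}"
  by (induction n) (auto intro: depends_only_on_euler)

text \<open>Influence travels from \<open>b + k\<close> to the support of \<open>f\<close> only through \<open>k\<close> ordered rings.\<close>

lemma euler_influence:
  fixes h :: real
  assumes h: "0 \<le> h" "h * real_of_int (R - a) \<le> 1" and aR: "a \<le> R"
    and f: "depends_only_on f {a..b}" and B: "\<And>\<xi>. \<bar>f \<xi>\<bar> \<le> B"
  shows "\<bar>(euler h a R ^^ n) f (\<xi>(b + int k := True)) - (euler h a R ^^ n) f (\<xi>(b + int k := False))\<bar>
    \<le> 2 * B * (real (n choose k) * h ^ k)"
proof -
  have bound: "\<bar>(euler h a R ^^ m) f \<zeta>\<bar> \<le> B" for m \<zeta>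
    using h aR B by (rule euler_funpow_bounded)
  show ?thesis
  proof (induction n arbitrary: k \<xi>)
    case 0
    show ?case
    proof (cases "k = 0")
      case True
      then have eq: "b + int k = b" "real (0 choose k) * h ^ k = 1" by auto
      show ?thesis
        unfolding eq using bound[of 0 "\<xi>(b := True)"] bound[of 0 "\<xi>(b := False)"] by linarith
    next
      case False
      then have "f (\<xi>(b + int k := True)) = f (\<xi>(b + int k := False))"
        by (intro f[unfolded depends_only_on_def, rule_format]) auto
      then have "(euler h a R ^^ 0) f (\<xi>(b + int k := True)) - (euler h a R ^^ 0) f (\<xi>(b + int k := False)) = 0"
        by (simp only: funpow.simps id_apply diff_self)
      moreover have "real (0 choose k) * h ^ k = 0" using False by simp
      ultimately show ?thesis by (simp only: abs_zero mult_zero_right order_refl)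
    qed
  next
    case (Suc n)
    define F where "F = (euler h a R ^^ n) f"
    show ?case
    proof (cases k)
      case 0
      then have eq: "b + int k = b" "real (Suc n choose k) * h ^ k = 1" by auto
      show ?thesis
        unfolding eq using bound[of "Suc n" "\<xi>(b := True)"] bound[of "Suc n" "\<xi>(b := False)"] by linarith
    next
      case (Suc j)
      have "\<bar>euler h a R F (\<xi>(b + int k := True)) - euler h a R F (\<xi>(b + int k := False))\<bar>
          \<le> 2 * B * (real (n choose k) * h ^ k) + h * (2 * B * (real (n choose j) * h ^ j))"
      proof (rule euler_influence_step[OF h aR])
        show "\<bar>F (\<zeta>(b + int k := True)) - F (\<zeta>(b + int k := False))\<bar>
            \<le> 2 * B * (real (n choose k) * h ^ k)" for \<zeta>
          unfolding F_def by (rule Suc.IH)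
        have "b + int k - 1 = b + int j" using Suc by simp
        then show "\<bar>F (\<zeta>(b + int k - 1 := True)) - F (\<zeta>(b + int k - 1 := False))\<bar>
            \<le> 2 * B * (real (n choose j) * h ^ j)" for \<zeta>
          unfolding F_def by (simp only: Suc.IH)
      qed
      \<comment> \<open>Pascal's rule: either the new step is one of the \<open>k\<close> ordered
        rings or it is not.\<close>
      also have "\<dots> = 2 * B * (real (Suc n choose k) * h ^ k)"
        by (simp add: Suc algebra_simps)
      finally show ?thesis by (simp only: F_def funpow.simps o_apply)
    qed
  qed
qed

end

section \<open>Local functions, kernels and expectations\<close>

text \<open>For finite \<open>A\<close> and \<open>B\<close> ranging over \<open>Pow A\<close> these
  indicators form a basis of the functions of the spins in \<open>A\<close>; its finiteness will
  make limits uniform over bounded functions on a window.\<close>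

definition cylinder :: "int set \<Rightarrow> int set \<Rightarrow> config \<Rightarrow> real" where
  "cylinder A B \<xi> = (\<Prod>y\<in>A. of_bool (\<xi> y = (y \<in> B)))"

lemma depends_only_on_cylinder: "depends_only_on (cylinder A B) A"
  by (auto simp: depends_only_on_def cylinder_def)

lemma local_fun_eq_sum_cylinder:
  assumes "finite A" "depends_only_on f A"
  shows "f \<xi> = (\<Sum>B\<in>Pow A. f (\<lambda>y. y \<in> B) * cylinder A B \<xi>)"
proof -
  define B0 where "B0 = {y \<in> A. \<xi> y}"
  have "cylinder A B \<xi> = 0" if B: "B \<in> Pow A - {B0}" for B
  proof -
    have "\<exists>y\<in>A. \<xi> y \<noteq> (y \<in> B)" using B by (auto simp: B0_def)
    then obtain y where "y \<in> A" "\<xi> y \<noteq> (y \<in> B)" by blast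
    with assms(1) show ?thesis unfolding cylinder_def by (intro prod_zero) auto
  qed
  then have "(\<Sum>B\<in>Pow A. f (\<lambda>y. y \<in> B) * cylinder A B \<xi>) = f (\<lambda>y. y \<in> B0) * cylinder A B0 \<xi>"
    using assms(1) by (subst sum.remove[of _ B0]) (auto simp: B0_def)
  also have "cylinder A B0 \<xi> = 1"
    unfolding cylinder_def B0_def by (intro prod.neutral) auto
  also have "f (\<lambda>y. y \<in> B0) = f \<xi>"
    by (rule assms(2)[unfolded depends_only_on_def, rule_format]) (simp add: B0_def)
  finally show ?thesis by simp
qed

text \<open>\<open>M\<close> is left open so that one argument serves both the Borel sets, on which
  the kernels live, and the product \<sigma>-algebra of \<open>bernoulli_product\<close>.\<close>

lemma local_fun_measurable_coordinates:
  assumes "finite A" "depends_only_on f A"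
    and [measurable]: "\<And>y. (\<lambda>\<xi>. \<xi> y) \<in> M \<rightarrow>\<^sub>M count_space UNIV"
  shows "f \<in> borel_measurable M"
proof -
  have "(\<lambda>\<xi>. \<Sum>B\<in>Pow A. f (\<lambda>y. y \<in> B) * cylinder A B \<xi>) \<in> borel_measurable M"
    unfolding cylinder_def by measurable
  moreover have "(\<lambda>\<xi>. \<Sum>B\<in>Pow A. f (\<lambda>y. y \<in> B) * cylinder A B \<xi>) = f"
    by (intro ext local_fun_eq_sum_cylinder[OF assms(1,2), symmetric])
  ultimately show ?thesis by (simp only:)
qed

lemma local_fun_measurable:
  assumes "finite A" "depends_only_on f A"
  shows "f \<in> borel_measurable borel"
proof (rule local_fun_measurable_coordinates[OF assms])
  fix y
  have "(\<lambda>\<xi>::config. \<xi> y) \<in> borel \<rightarrow>\<^sub>M (borel :: bool measure)"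
    by (intro borel_measurable_continuous_onI continuous_on_product_coordinates)
  then show "(\<lambda>\<xi>::config. \<xi> y) \<in> borel \<rightarrow>\<^sub>M count_space UNIV"
    by (simp only: measurable_cong_sets[OF refl sets_borel_eq_count_space])
qed

lemma local_fun_measurable_bernoulli_product:
  assumes "finite A" "depends_only_on f A"
  shows "f \<in> borel_measurable (bernoulli_product p)"
proof (rule local_fun_measurable_coordinates[OF assms])
  fix y
  have "(\<lambda>\<xi>::config. \<xi> y) \<in> bernoulli_product p \<rightarrow>\<^sub>M measure_pmf (bernoulli_pmf p)"
    unfolding bernoulli_product_def by (intro measurable_component_singleton) simp
  then show "(\<lambda>\<xi>::config. \<xi> y) \<in> bernoulli_product p \<rightarrow>\<^sub>M count_space UNIV" by simp
qed

lemma local_fun_bounded: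
  assumes "finite A" "depends_only_on f A"
  shows "\<exists>B. \<forall>\<xi>. \<bar>f \<xi>\<bar> \<le> B"
proof -
  have "range f \<subseteq> (\<lambda>B. f (\<lambda>y. y \<in> B)) ` Pow A"
  proof
    fix r assume "r \<in> range f"
    then obtain \<xi> where r: "r = f \<xi>" by blast
    have "f \<xi> = f (\<lambda>y. y \<in> {y \<in> A. \<xi> y})"
      by (rule assms(2)[unfolded depends_only_on_def, rule_format]) simp
    then show "r \<in> (\<lambda>B. f (\<lambda>y. y \<in> B)) ` Pow A" unfolding r by blast
  qed
  then have "finite (range f)"
    using assms(1) finite_subset by blast
  then have "bounded (range f)" by (rule finite_imp_bounded)
  then show ?thesis by (auto simp: bounded_iff)
qed

lemma prob_space_bernoulli_product: "prob_space (bernoulli_product p)"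
  unfolding bernoulli_product_def by (intro prob_space_PiM measure_pmf.prob_space_axioms)

lemma (in prob_space) abs_integral_le:
  assumes f: "f \<in> borel_measurable M" and le: "\<And>x. \<bar>f x\<bar> \<le> (B :: real)"
  shows "integrable M f" "\<bar>\<integral>x. f x \<partial>M\<bar> \<le> B"
proof -
  show int: "integrable M f"
    using le by (intro integrable_const_bound[of _ B] f) auto
  have "\<bar>\<integral>x. f x \<partial>M\<bar> \<le> (\<integral>x. \<bar>f x\<bar> \<partial>M)"
    using integral_norm_bound[of M f] by simp
  also have "\<dots> \<le> (\<integral>x. B \<partial>M)" using int le by (intro integral_mono) auto
  finally show "\<bar>\<integral>x. f x \<partial>M\<bar> \<le> B" by (simp add: prob_space)
qed

section \<open>Feller kernels and the law of the process at a fixed time\<close>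

lemma feller_kernel:
  assumes "feller_semigroup P" "0 \<le> t"
  shows "prob_space (P t x)" "sets (P t x) = sets borel"
proof -
  have "P t \<in> borel \<rightarrow>\<^sub>M prob_algebra borel" using assms by (simp add: feller_semigroup_def)
  then have "P t x \<in> space (prob_algebra borel)" by (rule measurable_space) simp
  then show "prob_space (P t x)" "sets (P t x) = sets borel" by (auto simp: space_prob_algebra)
qed

lemma integral_feller_add:
  fixes f :: "'a::topological_space \<Rightarrow> real"
  assumes P: "feller_semigroup P" and st: "0 \<le> s" "0 \<le> t"
    and f: "f \<in> borel_measurable borel" "\<And>y. \<bar>f y\<bar> \<le> B"
  shows "(\<integral>y. f y \<partial>P (s + t) x) = (\<integral>y. (\<integral>z. f z \<partial>P t y) \<partial>P s x)"
proof -
  interpret S: prob_space "P s x" by (rule feller_kernel(1)[OF P st(1)])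
  have "P t \<in> borel \<rightarrow>\<^sub>M subprob_algebra borel"
    using P st by (auto simp: feller_semigroup_def intro: measurable_prob_algebraD)
  then have N: "P t \<in> P s x \<rightarrow>\<^sub>M subprob_algebra borel"
    by (simp cong: measurable_cong_sets add: feller_kernel(2)[OF P st(1)])
  have "P (s + t) x = bind (P s x) (P t)" using P st by (simp add: feller_semigroup_def)
  moreover have "(\<integral>y. f y \<partial>bind (P s x) (P t)) = (\<integral>y. (\<integral>z. f z \<partial>P t y) \<partial>P s x)"
  proof (rule integral_bind[OF f(1) _ N])
    show "\<bar>f y\<bar> \<le> B" for y by (rule f(2))
    show "finite_measure (P s x)" by unfold_locales
    have "emeasure (P t y) (space (P t y)) \<le> ennreal 1" for y
      using prob_space.emeasure_space_1[OF feller_kernel(1)[OF P st(2)]] by simp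
    then show "AE y in P s x. emeasure (P t y) (space (P t y)) \<le> ennreal 1" by simp
  qed
  ultimately show ?thesis by simp
qed

lemma integral_feller_measurable:
  fixes f :: "'a::topological_space \<Rightarrow> real"
  assumes P: "feller_semigroup P" and t: "0 \<le> t" and f: "f \<in> borel_measurable borel"
  shows "(\<lambda>x. \<integral>y. f y \<partial>P t x) \<in> borel_measurable borel"
proof -
  have "P t \<in> borel \<rightarrow>\<^sub>M subprob_algebra borel"
    using P t by (auto simp: feller_semigroup_def intro: measurable_prob_algebraD)
  then show ?thesis
    by (rule measurable_compose[OF _ integral_measurable_subprob_algebra[OF f]])
qed

text \<open>Take expectations in the Markov property from time 0: almost surely \<open>X 0\<close>
  is \<open>x\<close>, so the conditional probability is the constant
  \<open>measure (P t x) B\<close>.\<close>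

lemma markov_process_law:
  fixes f :: "'a::topological_space \<Rightarrow> real"
  assumes P: "feller_semigroup P" and mp: "markov_process P x M X" and t: "0 \<le> t"
    and f: "f \<in> borel_measurable borel"
  shows "(\<integral>w. f (X t w) \<partial>M) = (\<integral>y. f y \<partial>P t x)"
proof -
  interpret prob_space M using mp by (simp add: markov_process_def)
  interpret Px: prob_space "P t x" by (rule feller_kernel(1)[OF P t])
  have X: "X u \<in> M \<rightarrow>\<^sub>M borel" if "0 \<le> u" for u
    using mp that by (simp add: markov_process_def)
  have "subalgebra M (past M X 0)"
  proof -
    have "{X u -` B \<inter> space M |u B. 0 \<le> u \<and> u \<le> 0 \<and> B \<in> sets borel} \<subseteq> sets M"
      using X by (auto intro: measurable_sets)
    moreover have "{X u -` B \<inter> space M |u B. 0 \<le> u \<and> u \<le> 0 \<and> B \<in> sets borel} \<subseteq> Pow (space M)"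
      by auto
    ultimately show ?thesis
      unfolding subalgebra_def past_def by (simp add: sets.sigma_sets_subset)
  qed
  then interpret finite_measure_subalgebra M "past M X 0" by unfold_locales
  interpret sigma_finite_subalgebra M "past M X 0"
    by (rule finite_measure_subalgebra_is_sigma_finite) unfold_locales
  have "distr M borel (X t) = P t x"
  proof (rule measure_eqI)
    show "sets (distr M borel (X t)) = sets (P t x)" by (simp add: feller_kernel(2)[OF P t])
    fix B assume "B \<in> sets (distr M borel (X t))"
    then have B: "B \<in> sets borel" by simp
    have ind: "(\<lambda>w. indicator B (X t w) :: real) \<in> borel_measurable M"
      using X[OF t] B by measurable
    have "(\<integral>w. 1 * indicator B (X t w) \<partial>M) = (\<integral>w. 1 * real_cond_exp M (past M X 0) (\<lambda>v. indicator B (X t v)) w \<partial>M)"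
      using ind by (intro real_cond_exp_intg(2)[symmetric]) (auto intro!: integrable_const_bound[of _ 1])
    also have "\<dots> = (\<integral>w. measure (P t x) B \<partial>M)"
    proof (rule integral_cong_AE)
      show "(\<lambda>w. 1 * real_cond_exp M (past M X 0) (\<lambda>v. indicator B (X t v)) w) \<in> borel_measurable M"
        by simp
      have "AE w in M. real_cond_exp M (past M X 0) (\<lambda>v. indicator B (X (0 + t) v)) w = measure (P t (X 0 w)) B"
        using mp t B by (simp only: markov_process_def)
      moreover have "AE w in M. X 0 w = x" using mp by (simp add: markov_process_def)
      ultimately show "AE w in M. 1 * real_cond_exp M (past M X 0) (\<lambda>v. indicator B (X t v)) w = measure (P t x) B"
        by eventually_elim simp
    qed simp
    also have "\<dots> = measure (P t x) B" by (simp add: prob_space)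
    also have "(\<integral>w. 1 * indicator B (X t w) \<partial>M) = (\<integral>y. (indicator B y :: real) \<partial>distr M borel (X t))"
      using integral_distr[OF X[OF t], of "indicator B :: _ \<Rightarrow> real"] B by simp
    also have "\<dots> = measure (distr M borel (X t)) B" using B by simp
    finally show "emeasure (distr M borel (X t)) B = emeasure (P t x) B"
      using prob_space_distr[OF X[OF t]] Px.emeasure_eq_measure
      by (simp add: finite_measure.emeasure_eq_measure prob_space.finite_measure)
  qed
  then show ?thesis
    using integral_distr[OF X[OF t] f] by simp
qed

section \<open>The product measure as an average over finitely many spins\<close>

context east
begin

lemma integral_bernoulli_avg:
  assumes A: "finite A" "depends_only_on f A"
  shows "(\<integral>\<xi>. avg x f \<xi> \<partial>bernoulli_product p) = (\<integral>\<xi>. f \<xi> \<partial>bernoulli_product p)"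
proof -
  interpret B: prob_space "bernoulli_product p" by (rule prob_space_bernoulli_product)
  define N where "N = measure_pmf (bernoulli_pmf p)"
  interpret N: prob_space N unfolding N_def by (rule measure_pmf.prob_space_axioms)
  interpret NB: pair_prob_space N "bernoulli_product p" ..
  let ?u = "\<lambda>(b, \<xi>). \<xi>(x := b)"
  \<comment> \<open>Since \<open>x\<close> already belongs to \<open>UNIV\<close>, the library fact
    about adding a coordinate describes here the resampling of one.\<close>
  have "distr (N \<Otimes>\<^sub>M (\<Pi>\<^sub>M i\<in>UNIV. N)) (\<Pi>\<^sub>M i\<in>insert x UNIV. N) ?u = (\<Pi>\<^sub>M i\<in>insert x UNIV. N)"
    by (rule distr_pair_PiM_eq_PiM) (rule N.prob_space_axioms)+
  then have distr: "distr (N \<Otimes>\<^sub>M bernoulli_product p) (bernoulli_product p) ?u = bernoulli_product p"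
    by (simp add: bernoulli_product_def N_def)
  have u: "?u \<in> (N \<Otimes>\<^sub>M bernoulli_product p) \<rightarrow>\<^sub>M bernoulli_product p"
    unfolding bernoulli_product_def N_def[symmetric]
    using measurable_fun_upd[of UNIV UNIV x snd "N \<Otimes>\<^sub>M PiM UNIV (\<lambda>_. N)" "\<lambda>_. N" fst]
    by (simp add: case_prod_beta')
  have f: "f \<in> borel_measurable (bernoulli_product p)"
    by (rule local_fun_measurable_bernoulli_product[OF A])
  obtain C where C: "\<And>\<xi>. \<bar>f \<xi>\<bar> \<le> C" using local_fun_bounded[OF A] by blast
  have fu: "(\<lambda>y. f (?u y)) \<in> borel_measurable (N \<Otimes>\<^sub>M bernoulli_product p)"
    by (rule measurable_compose[OF u f])
  have int: "integrable (N \<Otimes>\<^sub>M bernoulli_product p) (\<lambda>y. f (?u y))"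
    using C by (intro NB.abs_integral_le[OF fu]) auto
  have intb: "integrable (bernoulli_product p) (\<lambda>\<xi>. f (\<xi>(x := b)))" for b
  proof (rule B.abs_integral_le(1)[OF _ C])
    have "Pair b \<in> bernoulli_product p \<rightarrow>\<^sub>M N \<Otimes>\<^sub>M bernoulli_product p"
      by (rule measurable_Pair1') (simp add: N_def)
    from measurable_compose[OF this fu] show "(\<lambda>\<xi>. f (\<xi>(x := b))) \<in> borel_measurable (bernoulli_product p)"
      by simp
  qed
  have "(\<integral>\<xi>. f \<xi> \<partial>bernoulli_product p) = (\<integral>\<xi>. f \<xi> \<partial>distr (N \<Otimes>\<^sub>M bernoulli_product p) (bernoulli_product p) ?u)"
    by (simp only: distr)
  also have "\<dots> = (\<integral>y. f (?u y) \<partial>(N \<Otimes>\<^sub>M bernoulli_product p))"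
    by (rule integral_distr[OF u f])
  also have "\<dots> = (\<integral>b. (\<integral>\<xi>. f (?u (b, \<xi>)) \<partial>bernoulli_product p) \<partial>N)"
    by (rule NB.integral_fst'[OF int, symmetric])
  also have "\<dots> = (\<integral>\<xi>. f (\<xi>(x := True)) \<partial>bernoulli_product p) * p
      + (\<integral>\<xi>. f (\<xi>(x := False)) \<partial>bernoulli_product p) * (1 - p)"
    unfolding N_def prod.case using p_nonneg p_less_1 by (intro integral_bernoulli_pmf) auto
  also have "\<dots> = (\<integral>\<xi>. avg x f \<xi> \<partial>bernoulli_product p)"
    unfolding avg_def using intb by (simp add: mult.commute)
  finally show ?thesis by simp
qed

lemma depends_only_on_mean: "finite S \<Longrightarrow> depends_only_on g A \<Longrightarrow> depends_only_on (mean S g) A"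
  by (induction S rule: finite_induct) (auto simp: mean_insert depends_only_on_avg)

lemma integral_bernoulli_eq_mean:
  assumes A: "finite A" "depends_only_on f A"
  shows "(\<integral>\<xi>. f \<xi> \<partial>bernoulli_product p) = mean A f \<zeta>"
proof -
  interpret B: prob_space "bernoulli_product p" by (rule prob_space_bernoulli_product)
  have "(\<integral>\<xi>. mean S f \<xi> \<partial>bernoulli_product p) = (\<integral>\<xi>. f \<xi> \<partial>bernoulli_product p)" if "finite S" for S
    using that
  proof (induction S rule: finite_induct)
    case (insert x S)
    then show ?case
      using integral_bernoulli_avg[OF A(1) depends_only_on_mean[OF insert.hyps(1) A(2)]]
      by (simp add: mean_insert)
  qed simp
  from this[OF A(1)] have "(\<integral>\<xi>. mean A f \<xi> \<partial>bernoulli_product p) = (\<integral>\<xi>. f \<xi> \<partial>bernoulli_product p)" .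
  moreover have "mean A f = (\<lambda>_. mean A f \<zeta>)"
  proof (rule ext)
    fix \<xi>
    \<comment> \<open>\<open>mean A f\<close> depends only on the spins in \<open>A\<close>, and
      also only on those outside \<open>A\<close>, hence on nothing; the hybrid \<xi>' links \<xi>
      to \<zeta>.\<close>
    define \<xi>' where "\<xi>' y = (if y \<in> A then \<xi> y else \<zeta> y)" for y
    have "mean A f \<xi> = mean A f \<xi>'"
      by (rule depends_only_on_mean[OF A, unfolded depends_only_on_def, rule_format]) (simp add: \<xi>'_def)
    also have "\<dots> = mean A f \<zeta>"
      by (rule depends_mean[OF A(1), unfolded depends_only_on_def, rule_format]) (simp add: \<xi>'_def)
    finally show "mean A f \<xi> = mean A f \<zeta>" .
  qed
  ultimately have "(\<integral>\<xi>. f \<xi> \<partial>bernoulli_product p) = (\<integral>_. mean A f \<zeta> \<partial>bernoulli_product p)"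
    by simp
  then show ?thesis by (simp add: B.prob_space)
qed

section \<open>Convergence of the Euler scheme to the semigroup\<close>

lemma site_average_eq: "site_average p x f \<xi> = avg x f \<xi>"
  unfolding site_average_def avg_def using p_nonneg p_less_1 by (simp add: mult.commute)

lemma east_generator_eq:
  assumes "depends_only_on g {a..R}"
  shows "east_generator p g \<xi> = (\<Sum>x\<in>{a..R}. of_bool (\<not> \<xi> (x + 1)) * (avg x g \<xi> - g \<xi>))"
proof -
  have "1 - of_bool b = (of_bool (\<not> b) :: real)" for b by (cases b) auto
  then show ?thesis
    by (simp only: east_generator_eq_sum[OF finite_atLeastAtMost_int assms] site_average_eq)
qed

text \<open>The two differ only in the ring at \<open>R\<close>, frozen in the scheme and active in
  the generator; its effect is at most the influence of the spin at \<open>R\<close>.\<close>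

lemma euler_generator_diff:
  assumes g: "depends_only_on g {a..R}" and "a \<le> R" "0 \<le> h"
  shows "\<bar>g \<xi> + h * east_generator p g \<xi> - euler h a R g \<xi>\<bar>
    \<le> h * \<bar>g (\<xi>(R := True)) - g (\<xi>(R := False))\<bar>"
proof -
  define d where "d x = of_bool (\<not> \<xi> (x + 1)) * (avg x g \<xi> - g \<xi>)" for x
  have "{a..R} = insert R {a..<R}" using assms(2) by auto
  then have "g \<xi> + h * east_generator p g \<xi> - euler h a R g \<xi> = h * d R"
    unfolding east_generator_eq[OF g] euler_def d_def[symmetric] by (simp add: algebra_simps)
  moreover have "\<bar>d R\<bar> \<le> \<bar>g (\<xi>(R := True)) - g (\<xi>(R := False))\<bar>"
    using abs_avg_diff_le[of R g \<xi>] by (simp add: d_def abs_mult)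
  ultimately show ?thesis using assms(3) by (simp only: abs_mult) (simp add: mult_left_mono)
qed

lemma avg_sum_scale:
  "avg x (\<lambda>\<xi>. \<Sum>i\<in>I. c i * g i \<xi>) \<xi> = (\<Sum>i\<in>I. c i * avg x (g i) \<xi>)"
  by (simp add: avg_def sum_distrib_left sum.distrib sum_subtractf algebra_simps)

lemma east_generator_cylinder_sum:
  assumes g: "depends_only_on g {a..R}"
  shows "east_generator p g \<xi>
    = (\<Sum>B\<in>Pow {a..R}. g (\<lambda>y. y \<in> B) * east_generator p (cylinder {a..R} B) \<xi>)"
proof -
  define v where "v B = g (\<lambda>y. y \<in> B)" for B
  have eq: "g = (\<lambda>\<xi>. \<Sum>B\<in>Pow {a..R}. v B * cylinder {a..R} B \<xi>)"
    unfolding v_def using g by (intro ext local_fun_eq_sum_cylinder) auto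
  have "avg x g \<xi> - g \<xi> = (\<Sum>B\<in>Pow {a..R}. v B * (avg x (cylinder {a..R} B) \<xi> - cylinder {a..R} B \<xi>))" for x
    unfolding eq avg_sum_scale by (simp only: right_diff_distrib sum_subtractf)
  then show ?thesis
    unfolding east_generator_eq[OF g] east_generator_eq[OF depends_only_on_cylinder]
    by (simp only: v_def[symmetric] sum_distrib_left mult.left_commute) (rule sum.swap)
qed

text \<open>The generator is known function by function, but the Euler iterates it is applied to
  change with \<open>h\<close>. Bounded functions on a window are combinations of finitely many
  cylinder functions with bounded coefficients, so one \<delta> serves them all.\<close>

lemma generator_uniform:
  assumes P: "east_semigroup p P" and \<epsilon>: "0 < \<epsilon>"
  shows "\<exists>\<delta>>0. \<forall>(h::real) g \<xi>. 0 < h \<longrightarrow> h < \<delta> \<longrightarrow> depends_only_on g {a..R} \<longrightarrow> (\<forall>\<xi>. \<bar>g \<xi>\<bar> \<le> B) \<longrightarrow>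
    \<bar>(\<integral>y. g y \<partial>P h \<xi>) - g \<xi> - h * east_generator p g \<xi>\<bar> \<le> h * \<epsilon>"
proof -
  define \<C> where "\<C> = Pow {a..R}"
  have fin: "finite \<C>" by (simp add: \<C>_def)
  define c where "c D = cylinder {a..R} D" for D
  \<comment> \<open>The error is shared among the cylinder functions; the added 1 keeps the
    denominator positive.\<close>
  define \<epsilon>' where "\<epsilon>' = \<epsilon> / (\<bar>B\<bar> * card \<C> + 1)"
  have pos: "0 < \<bar>B\<bar> * card \<C> + 1" by (intro add_nonneg_pos) auto
  have \<epsilon>': "0 < \<epsilon>'" using \<epsilon> pos by (simp add: \<epsilon>'_def)
  have "\<bar>B\<bar> * card \<C> * \<epsilon>' \<le> (\<bar>B\<bar> * card \<C> + 1) * \<epsilon>'"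
    using \<epsilon>' by (intro mult_right_mono) auto
  also have "\<dots> = \<epsilon>" using pos by (simp add: \<epsilon>'_def)
  finally have \<epsilon>'_le: "\<bar>B\<bar> * card \<C> * \<epsilon>' \<le> \<epsilon>" .
  have F: "feller_semigroup P" using P by (simp add: east_semigroup_def)
  have "\<forall>\<^sub>F h in at_right 0. \<forall>\<xi>\<in>UNIV.
      dist (((\<integral>y. c D y \<partial>P h \<xi>) - c D \<xi>) / h) (east_generator p (c D) \<xi>) < \<epsilon>'" for D
  proof -
    have "local_fun (c D)"
      unfolding local_fun_def c_def by (intro exI[of _ "{a..R}"] conjI depends_only_on_cylinder) simp
    then have "(c D, east_generator p (c D)) \<in> generator P"
      using P by (simp add: east_semigroup_def)
    then show ?thesis
      using \<epsilon>' by (auto simp: generator_def dest!: uniform_limitD)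
  qed
  then have "\<forall>\<^sub>F h in at_right 0. \<forall>D\<in>\<C>. \<forall>\<xi>\<in>UNIV.
      dist (((\<integral>y. c D y \<partial>P h \<xi>) - c D \<xi>) / h) (east_generator p (c D) \<xi>) < \<epsilon>'"
    by (intro eventually_ball_finite[OF fin]) blast
  then obtain \<delta> where \<delta>: "0 < \<delta>" and gen: "\<And>h D \<xi>. 0 < h \<Longrightarrow> h < \<delta> \<Longrightarrow> D \<in> \<C> \<Longrightarrow>
      dist (((\<integral>y. c D y \<partial>P h \<xi>) - c D \<xi>) / h) (east_generator p (c D) \<xi>) < \<epsilon>'"
    unfolding eventually_at_right_field by blast
  show ?thesis
  proof (rule exI[of _ \<delta>], intro conjI allI impI \<delta>)
    fix h :: real and g \<xi>
    assume h: "0 < h" "h < \<delta>" and g: "depends_only_on g {a..R}" and B: "\<forall>\<xi>. \<bar>g \<xi>\<bar> \<le> B"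
    interpret prob_space "P h \<xi>" using h by (intro feller_kernel(1)[OF F]) simp
    define v where "v D = g (\<lambda>y. y \<in> D)" for D
    have eq: "g \<zeta> = (\<Sum>D\<in>\<C>. v D * c D \<zeta>)" for \<zeta>
      unfolding \<C>_def v_def c_def using g by (intro local_fun_eq_sum_cylinder) auto
    have "integrable (P h \<xi>) (c D)" for D
    proof (rule abs_integral_le(1))
      have "c D \<in> borel_measurable borel"
        unfolding c_def by (rule local_fun_measurable[OF _ depends_only_on_cylinder]) simp
      then show "c D \<in> borel_measurable (P h \<xi>)"
        using h by (simp cong: measurable_cong_sets add: feller_kernel(2)[OF F])
      show "\<bar>c D y\<bar> \<le> 1" for y
        by (auto simp: c_def cylinder_def abs_prod intro!: prod_le_1)
    qed
    then have int: "(\<integral>y. g y \<partial>P h \<xi>) = (\<Sum>D\<in>\<C>. v D * (\<integral>y. c D y \<partial>P h \<xi>))"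
      unfolding eq by simp
    have "(\<integral>y. g y \<partial>P h \<xi>) - g \<xi> - h * east_generator p g \<xi>
        = (\<Sum>D\<in>\<C>. v D * ((\<integral>y. c D y \<partial>P h \<xi>) - c D \<xi> - h * east_generator p (c D) \<xi>))"
      unfolding int eq[of \<xi>] east_generator_cylinder_sum[OF g]
      by (simp add: \<C>_def v_def c_def sum_subtractf right_diff_distrib sum_distrib_left mult.left_commute)
    also have "\<bar>\<dots>\<bar> \<le> (\<Sum>D\<in>\<C>. \<bar>B\<bar> * (h * \<epsilon>'))"
    proof (rule order.trans[OF sum_abs sum_mono])
      fix D assume D: "D \<in> \<C>"
      have "\<bar>(\<integral>y. c D y \<partial>P h \<xi>) - c D \<xi> - h * east_generator p (c D) \<xi>\<bar>
          = h * dist (((\<integral>y. c D y \<partial>P h \<xi>) - c D \<xi>) / h) (east_generator p (c D) \<xi>)"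
      proof -
        have "h * \<bar>u / h - w\<bar> = \<bar>u - h * w\<bar>" for u w
        proof -
          have "h * \<bar>u / h - w\<bar> = \<bar>h * (u / h - w)\<bar>" using h(1) by (simp add: abs_mult)
          also have "h * (u / h - w) = u - h * w" using h(1) by (simp add: right_diff_distrib)
          finally show ?thesis .
        qed
        then show ?thesis by (simp only: dist_real_def)
      qed
      also have "\<dots> \<le> h * \<epsilon>'" using gen[OF h D, of \<xi>] h(1) by (intro mult_left_mono) auto
      finally have "\<bar>(\<integral>y. c D y \<partial>P h \<xi>) - c D \<xi> - h * east_generator p (c D) \<xi>\<bar> \<le> h * \<epsilon>'" .
      moreover have "\<bar>v D\<bar> \<le> \<bar>B\<bar>" unfolding v_def using B order.trans[OF _ abs_ge_self] by blast
      ultimately show "\<bar>v D * ((\<integral>y. c D y \<partial>P h \<xi>) - c D \<xi> - h * east_generator p (c D) \<xi>)\<bar> \<le> \<bar>B\<bar> * (h * \<epsilon>')"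
        by (simp only: abs_mult) (intro mult_mono, auto)
    qed
    also have "\<dots> = h * (\<bar>B\<bar> * card \<C> * \<epsilon>')" by simp
    also have "\<dots> \<le> h * \<epsilon>" using \<epsilon>'_le h(1) by (intro mult_left_mono) auto
    finally show "\<bar>(\<integral>y. g y \<partial>P h \<xi>) - g \<xi> - h * east_generator p g \<xi>\<bar> \<le> h * \<epsilon>" .
  qed
qed

text \<open>Local errors add up, because \<open>P h\<close> does not increase the supremum norm.
  Each step contributes \<open>h * \<epsilon>\<close> from the generator and \<open>h\<close> times
  the influence of the spin at \<open>R\<close>, which is \<open>k\<close> ordered rings away from
  the support. Bounding this influence by \<open>n\<close> instead of \<open>m\<close> makes the
  error the same in all steps.\<close>

lemma semigroup_euler_diff:
  assumes P: "feller_semigroup P" and h: "0 < h" "h * real_of_int (R - a) \<le> 1"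
    and ab: "a \<le> b" and R: "R = b + int k"
    and f: "depends_only_on f {a..b}" and B: "\<And>\<xi>. \<bar>f \<xi>\<bar> \<le> B"
    and gen: "\<And>g \<xi>. depends_only_on g {a..R} \<Longrightarrow> (\<And>\<xi>. \<bar>g \<xi>\<bar> \<le> B) \<Longrightarrow>
      \<bar>(\<integral>y. g y \<partial>P h \<xi>) - g \<xi> - h * east_generator p g \<xi>\<bar> \<le> h * \<epsilon>"
    and n: "m \<le> n"
  shows "\<bar>(\<integral>y. f y \<partial>P (real m * h) \<xi>) - (euler h a R ^^ m) f \<xi>\<bar>
    \<le> real m * (h * (\<epsilon> + 2 * B * ((real n * h) ^ k / fact k)))"
  using n
proof (induction m arbitrary: \<xi>)
  case 0
  have "f \<in> borel_measurable borel" by (rule local_fun_measurable[OF _ f]) simp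
  moreover have "P 0 \<xi> = return borel \<xi>" using P by (simp add: feller_semigroup_def)
  ultimately show ?case by (simp add: integral_return)
next
  case (Suc m)
  define F where "F = (euler h a R ^^ m) f"
  define \<rho> where "\<rho> = 2 * B * ((real n * h) ^ k / fact k)"
  define u where "u y = (\<integral>z. f z \<partial>P (real m * h) y)" for y
  have B0: "0 \<le> B" using B abs_ge_zero order.trans by blast
  have aR: "a \<le> R" using ab R by simp
  have fR: "depends_only_on f {a..R}" using f R by (auto simp: depends_only_on_def)
  have F: "depends_only_on F {a..R}" unfolding F_def by (rule depends_only_on_euler_funpow[OF fR])
  have FB: "\<bar>F \<zeta>\<bar> \<le> B" for \<zeta>
    unfolding F_def using h aR B by (intro euler_funpow_bounded) auto
  have meas: "f \<in> borel_measurable borel" "F \<in> borel_measurable borel"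
    using local_fun_measurable[OF _ f] local_fun_measurable[OF _ F] by auto
  have mh: "0 \<le> real m * h" "0 \<le> h" using h by auto
  interpret Ph: prob_space "P h \<xi>" by (rule feller_kernel(1)[OF P mh(2)])
  interpret Pm: prob_space "P (real m * h) y" for y by (rule feller_kernel(1)[OF P mh(1)])
  have sets: "sets (P t y) = sets borel" if "0 \<le> t" for t y by (rule feller_kernel(2)[OF P that])
  have u_meas: "u \<in> borel_measurable borel"
    unfolding u_def by (rule integral_feller_measurable[OF P mh(1) meas(1)])
  have u_B: "\<bar>u y\<bar> \<le> B" for y
    unfolding u_def using meas(1) B
    by (intro Pm.abs_integral_le(2)) (simp_all cong: measurable_cong_sets add: sets[OF mh(1)])
  have borel_Ph: "g \<in> borel_measurable (P h \<xi>)" if "g \<in> borel_measurable borel" for g :: "config \<Rightarrow> real"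
    using that by (simp cong: measurable_cong_sets add: sets[OF mh(2)])
  have int: "integrable (P h \<xi>) u" "integrable (P h \<xi>) F"
    using Ph.abs_integral_le(1)[OF borel_Ph[OF u_meas] u_B] Ph.abs_integral_le(1)[OF borel_Ph[OF meas(2)] FB] by auto
  have step: "(\<integral>y. f y \<partial>P (real (Suc m) * h) \<xi>) = (\<integral>y. u y \<partial>P h \<xi>)"
    using integral_feller_add[OF P mh(2,1) meas(1) B, of \<xi>]
    by (simp add: u_def distrib_right)
  have "\<bar>(\<integral>y. u y - F y \<partial>P h \<xi>)\<bar> \<le> real m * (h * (\<epsilon> + \<rho>))"
  proof (rule Ph.abs_integral_le(2))
    show "(\<lambda>y. u y - F y) \<in> borel_measurable (P h \<xi>)"
      using borel_Ph[OF u_meas] borel_Ph[OF meas(2)] by simp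
    show "\<bar>u y - F y\<bar> \<le> real m * (h * (\<epsilon> + \<rho>))" for y
      using Suc.IH[of y] Suc.prems by (simp add: u_def F_def \<rho>_def)
  qed
  moreover have "(\<integral>y. u y - F y \<partial>P h \<xi>) = (\<integral>y. u y \<partial>P h \<xi>) - (\<integral>y. F y \<partial>P h \<xi>)"
    using int by simp
  moreover have "\<bar>(\<integral>y. F y \<partial>P h \<xi>) - F \<xi> - h * east_generator p F \<xi>\<bar> \<le> h * \<epsilon>"
    by (rule gen[OF F FB])
  moreover have "\<bar>F \<xi> + h * east_generator p F \<xi> - euler h a R F \<xi>\<bar> \<le> h * \<rho>"
  proof -
    have "\<bar>F (\<xi>(R := True)) - F (\<xi>(R := False))\<bar> \<le> 2 * B * (real (m choose k) * h ^ k)"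
      unfolding F_def R using mh(2) h(2) aR f B unfolding R by (rule euler_influence)
    also have "\<dots> \<le> \<rho>"
    proof -
      have "real (m choose k) * fact k \<le> real m ^ k"
        using binomial_fact_pow[of m k] by (metis of_nat_fact of_nat_le_iff of_nat_mult of_nat_power)
      also have "\<dots> \<le> real n ^ k" using Suc.prems by (intro power_mono) auto
      finally have "real (m choose k) * h ^ k \<le> real n ^ k / fact k * h ^ k"
        using mh(2) by (intro mult_right_mono) (auto simp: field_simps)
      also have "\<dots> = (real n * h) ^ k / fact k" by (simp add: power_mult_distrib)
      finally show ?thesis unfolding \<rho>_def using B0 by (intro mult_left_mono) auto
    qed
    finally have "h * \<bar>F (\<xi>(R := True)) - F (\<xi>(R := False))\<bar> \<le> h * \<rho>"
      using mh(2) by (rule mult_left_mono)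
    then show ?thesis using euler_generator_diff[OF F aR mh(2), of \<xi>] by linarith
  qed
  ultimately have "\<bar>(\<integral>y. u y \<partial>P h \<xi>) - euler h a R F \<xi>\<bar> \<le> real m * (h * (\<epsilon> + \<rho>)) + (h * \<epsilon> + h * \<rho>)"
    by linarith
  also have "\<dots> = real (Suc m) * (h * (\<epsilon> + \<rho>))" by (simp add: algebra_simps)
  finally show ?case unfolding step by (simp only: F_def \<rho>_def funpow.simps o_apply)
qed

lemma semigroup_decay:
  assumes inf: "infinite {x. x > 0 \<and> \<not> \<eta> x}" and P: "east_semigroup p P"
  shows "\<exists>m>0. \<forall>f. local_fun f \<longrightarrow> (\<exists>C. \<forall>t>0.
    \<bar>(\<integral>y. f y \<partial>P t \<eta>) - (\<integral>\<xi>. f \<xi> \<partial>bernoulli_product p)\<bar> \<le> C * exp (- m * t))"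
proof -
  have F: "feller_semigroup P" using P by (simp add: east_semigroup_def)
  obtain m where m: "m > 0" and decay: "\<And>a b z \<eta> f B. a \<le> b \<Longrightarrow> b < z \<Longrightarrow> \<not> \<eta> z \<Longrightarrow> depends_only_on f {a..b} \<Longrightarrow>
     (\<And>\<xi>. \<bar>f \<xi>\<bar> \<le> B) \<Longrightarrow> (\<And>\<xi>. mean {a..b} f \<xi> = 0) \<Longrightarrow>
     \<exists>C. \<forall>R\<ge>z. \<exists>h0>0. \<forall>(h::real) n. 0 < h \<longrightarrow> h < h0 \<longrightarrow>
        \<bar>(euler h a R ^^ n) f \<eta>\<bar> \<le> C * exp (- (m * (h * real n)))"
    using euler_decay by metis
  show ?thesis
  proof (rule exI[of _ m], intro conjI allI impI m)
    fix f :: "config \<Rightarrow> real" assume "local_fun f"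
    then obtain A where A: "finite A" "depends_only_on f A" by (auto simp: local_fun_def)
    \<comment> \<open>Inserting 0 keeps \<open>Min\<close> and \<open>Max\<close> meaningful when
      \<open>A\<close> is empty.\<close>
    define a b where "a = Min (insert 0 A)" and "b = Max (insert 0 A)"
    have "a \<le> 0" "0 \<le> b" unfolding a_def b_def using A(1) by (intro Min_le Max_ge; simp)+
    then have "a \<le> b" by (rule order.trans)
    moreover have "A \<subseteq> {a..b}" using A(1) by (auto simp: a_def b_def)
    ultimately have ab: "a \<le> b" "A \<subseteq> {a..b}" .
    have fab: "depends_only_on f {a..b}" using A(2) ab(2) unfolding depends_only_on_def by blast
    define \<mu> where "\<mu> = (\<integral>\<xi>. f \<xi> \<partial>bernoulli_product p)"
    define f0 where "f0 \<xi> = f \<xi> - \<mu>" for \<xi>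
    have f0: "depends_only_on f0 {a..b}"
      using depends_only_on_comp[OF fab, of "\<lambda>x. x - \<mu>"] by (simp add: f0_def[abs_def])
    have zero: "mean {a..b} f0 \<xi> = 0" for \<xi>
      using integral_bernoulli_eq_mean[OF _ fab, of \<xi>] by (simp add: f0_def[abs_def] mean_diff \<mu>_def)
    obtain B where B: "\<And>\<xi>. \<bar>f0 \<xi>\<bar> \<le> B" using local_fun_bounded[OF _ f0] by auto
    have B0: "0 \<le> B" using B abs_ge_zero order.trans by blast
    \<comment> \<open>Infinitely many zeros on the right provide one beyond any support.\<close>
    obtain z where z: "b < z" "\<not> \<eta> z"
    proof -
      have "\<not> {x. x > 0 \<and> \<not> \<eta> x} \<subseteq> {0..b}" using inf finite_subset by blast
      then show ?thesis using that by (force simp: not_le)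
    qed
    from decay[of a b z \<eta> f0 B, OF ab(1) z f0] B zero obtain C where C: "\<And>R. R \<ge> z \<Longrightarrow> \<exists>h0>0. \<forall>(h::real) n. 0 < h \<longrightarrow> h < h0 \<longrightarrow>
        \<bar>(euler h a R ^^ n) f0 \<eta>\<bar> \<le> C * exp (- (m * (h * real n)))" by metis
    show "\<exists>C. \<forall>t>0. \<bar>(\<integral>y. f y \<partial>P t \<eta>) - (\<integral>\<xi>. f \<xi> \<partial>bernoulli_product p)\<bar> \<le> C * exp (- m * t)"
    proof (rule exI[of _ C], intro allI impI)
      fix t :: real assume t: "0 < t"
      interpret Pt: prob_space "P t \<eta>" using t by (intro feller_kernel(1)[OF F]) simp
      have "f \<in> borel_measurable borel" by (rule local_fun_measurable[OF A])
      then have "f \<in> borel_measurable (P t \<eta>)"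
        using t by (simp cong: measurable_cong_sets add: feller_kernel(2)[OF F])
      moreover obtain B' where "\<And>\<xi>. \<bar>f \<xi>\<bar> \<le> B'" using local_fun_bounded[OF A] by blast
      ultimately have "integrable (P t \<eta>) f" by (rule Pt.abs_integral_le(1))
      then have shift: "(\<integral>y. f0 y \<partial>P t \<eta>) = (\<integral>y. f y \<partial>P t \<eta>) - \<mu>"
        by (simp add: f0_def Pt.prob_space)
      have "\<bar>\<integral>y. f0 y \<partial>P t \<eta>\<bar> \<le> C * exp (- m * t)"
      proof (rule field_le_epsilon)
        fix e :: real assume e: "0 < e"
        \<comment> \<open>For the tolerance \<open>e\<close> the distance \<open>k\<close> of the
          freezing site is chosen first, then \<epsilon>, then the mesh; boundary error and
          generator error get half of \<open>e\<close> each.\<close>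
        have "(\<lambda>k. t * (2 * B * (t ^ k / fact k))) \<longlonglongrightarrow> t * (2 * B * 0)"
          using summable_LIMSEQ_zero[OF summable_exp[of t]]
          by (intro tendsto_mult tendsto_const) (simp add: field_simps)
        then have "\<forall>\<^sub>F k in sequentially. t * (2 * B * (t ^ k / fact k)) < e / 2"
          using e by (intro order_tendstoD(2)) auto
        moreover have "\<forall>\<^sub>F k in sequentially. nat (z - b) \<le> k" by (rule eventually_ge_at_top)
        ultimately have "\<forall>\<^sub>F k in sequentially. t * (2 * B * (t ^ k / fact k)) < e / 2 \<and> nat (z - b) \<le> k"
          by (rule eventually_conj)
        then obtain k where k: "t * (2 * B * (t ^ k / fact k)) < e / 2" "nat (z - b) \<le> k"
          using eventually_happens by fastforce
        define R where "R = b + int k"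
        have R: "z \<le> R" using k(2) by (simp add: R_def)
        obtain h0 where h0: "0 < h0" and bound: "\<And>h n. 0 < h \<Longrightarrow> h < h0 \<Longrightarrow>
            \<bar>(euler h a R ^^ n) f0 \<eta>\<bar> \<le> C * exp (- (m * (h * real n)))"
          using C[OF R] by blast
        define \<epsilon> where "\<epsilon> = e / (2 * t)"
        have \<epsilon>: "0 < \<epsilon>" using e t by (simp add: \<epsilon>_def)
        obtain \<delta> where \<delta>: "0 < \<delta>" and gen: "\<And>(h::real) g \<xi>. 0 < h \<Longrightarrow> h < \<delta> \<Longrightarrow> depends_only_on g {a..R} \<Longrightarrow>
            (\<And>\<xi>. \<bar>g \<xi>\<bar> \<le> B) \<Longrightarrow> \<bar>(\<integral>y. g y \<partial>P h \<xi>) - g \<xi> - h * east_generator p g \<xi>\<bar> \<le> h * \<epsilon>"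
          using generator_uniform[OF P \<epsilon>, of a R B] by blast
        have Ra: "0 < real_of_int (R - a)" using ab(1) z(1) R by simp
        define h1 where "h1 = Min {h0, \<delta>, 1 / real_of_int (R - a)}"
        have h1: "0 < h1" "h1 \<le> h0" "h1 \<le> \<delta>" "h1 \<le> 1 / real_of_int (R - a)"
          using h0 \<delta> Ra by (simp_all add: h1_def)
        \<comment> \<open>The mesh must divide \<open>t\<close> exactly and stay below
          \<open>h1\<close>, so the number of steps is fixed before \<open>h\<close>.\<close>
        obtain n where n: "t / h1 < real n" using reals_Archimedean2 by blast
        have "0 < t / h1" using t h1 by simp
        then have n0: "0 < real n" using n by linarith
        define h where "h = t / real n"
        have h: "0 < h" "h < h1" "real n * h = t"
          using t n0 n h1(1) by (auto simp: h_def field_simps)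
        have hR: "h * real_of_int (R - a) \<le> 1"
        proof -
          have "h \<le> 1 / real_of_int (R - a)" using h h1 by linarith
          then show ?thesis using Ra by (simp add: field_simps)
        qed
        have "\<bar>(\<integral>y. f0 y \<partial>P (real n * h) \<eta>) - (euler h a R ^^ n) f0 \<eta>\<bar>
            \<le> real n * (h * (\<epsilon> + 2 * B * ((real n * h) ^ k / fact k)))"
          using F h(1) hR ab(1) R_def f0 B gen[OF h(1)] h(2) h1(3)
          by (intro semigroup_euler_diff) auto
        also have "\<dots> = t * \<epsilon> + t * (2 * B * (t ^ k / fact k))"
          unfolding h(3) mult.assoc[symmetric, of "real n" h] by (rule distrib_left)
        also have "\<dots> \<le> e" using k(1) t by (simp add: \<epsilon>_def)
        finally have "\<bar>(\<integral>y. f0 y \<partial>P t \<eta>) - (euler h a R ^^ n) f0 \<eta>\<bar> \<le> e" by (simp only: h(3))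
        moreover have "\<bar>(euler h a R ^^ n) f0 \<eta>\<bar> \<le> C * exp (- m * t)"
          using bound[OF h(1), of n] h h1 by (simp add: mult.commute)
        ultimately show "\<bar>\<integral>y. f0 y \<partial>P t \<eta>\<bar> \<le> C * exp (- m * t) + e" by linarith
      qed
      then show "\<bar>(\<integral>y. f y \<partial>P t \<eta>) - (\<integral>\<xi>. f \<xi> \<partial>bernoulli_product p)\<bar> \<le> C * exp (- m * t)"
        by (simp add: shift \<mu>_def)
    qed
  qed
qed

end

theorem theorem3p1:
  fixes p :: real and \<eta> :: config
    and M :: "'w measure" and X :: "real \<Rightarrow> 'w \<Rightarrow> config"
  assumes "0 \<le> p" and "p < 1"
    and "infinite {x. x > 0 \<and> \<not> \<eta> x}"
    and "east_process p \<eta> M X"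
  shows "\<exists>m>0. \<forall>f. local_fun f \<longrightarrow>
           (\<exists>C t\<^sub>0. \<forall>t>t\<^sub>0. 0 \<le> t \<longrightarrow>
              \<bar>(\<integral>w. f (X t w) \<partial>M) - (\<integral>\<xi>. f \<xi> \<partial>bernoulli_product p)\<bar> \<le> C * exp (- m * t))"
proof -
  interpret east p using assms(1,2) by unfold_locales
  obtain P where P: "east_semigroup p P" "markov_process P \<eta> M X"
    using assms(4) by (auto simp: east_process_def)
  have F: "feller_semigroup P" using P(1) by (simp add: east_semigroup_def)
  obtain m where m: "m > 0" and decay: "\<And>f. local_fun f \<Longrightarrow> \<exists>C. \<forall>t>0.
    \<bar>(\<integral>y. f y \<partial>P t \<eta>) - (\<integral>\<xi>. f \<xi> \<partial>bernoulli_product p)\<bar> \<le> C * exp (- m * t)"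
    using semigroup_decay[OF assms(3) P(1)] by blast
  show ?thesis
  proof (rule exI[of _ m], intro conjI allI impI m)
    fix f :: "config \<Rightarrow> real" assume f: "local_fun f"
    then have meas: "f \<in> borel_measurable borel"
      by (auto simp: local_fun_def intro: local_fun_measurable)
    obtain C where "\<forall>t>0. \<bar>(\<integral>y. f y \<partial>P t \<eta>) - (\<integral>\<xi>. f \<xi> \<partial>bernoulli_product p)\<bar> \<le> C * exp (- m * t)"
      using decay[OF f] by blast
    then show "\<exists>C t\<^sub>0. \<forall>t>t\<^sub>0. 0 \<le> t \<longrightarrow>
        \<bar>(\<integral>w. f (X t w) \<partial>M) - (\<integral>\<xi>. f \<xi> \<partial>bernoulli_product p)\<bar> \<le> C * exp (- m * t)"
      using markov_process_law[OF F P(2) _ meas] by (intro exI[of _ C] exI[of _ 0]) auto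
  qed
qed

end
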